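(* Let $n\ge m\ge 1$ be integers with $n-m>2$. The representation $\tau$ of $H=SO(n,m)$ on the Hilbert space $\mathcal{H}$ is irreducible.
   Context: $H=SO(n,m)$ is the group of real $(n+m)\times(n+m)$ matrices of determinant one preserving the form $u_1v_1+\dots+u_nv_n-u_{n+1}v_{n+1}-\dots-u_{n+m}v_{n+m}$. It acts on $Y=\{v\in M_{nm}(\mathbb{R}):v^tv=I_m\}$ by $h(v)=(Av+B)(Cv+D)^{-1}$ for $h=\begin{pmatrix}A&B\\C&D\end{pmatrix}$, $A$ of size $n\times n$. $L=S(O(n)\times O(m))\subset H$ is the subgroup of block diagonal matrices and $\omega$ is the normalised $L$-invariant (equivalently $O(n)\times O(m)$-invariant) measure on $Y$. $J_h(v)=\det(Cv+D)^{-(n+m)}$ is the complex Jacobian of the fractional linear action of $h$ on $n\times m$ matrices, with $J_h(v)^s=|\det(Cv+D)|^{-s(n+m)}$ for $v\in Y$. $\mathscr{C}_0$ is the space of continuous $f:Y\to\mathbb{C}$ such that $F_r(u)=\int_Yf(v)\det(I_n-ruv^t)^{-1}d\omega(v)$ ($r\in(0,1)$) converges uniformly on $Y$ to a function $F$ as $r\to1$. On $\mathscr{C}_0$ one has the positive semidefinite form $\langle f,g\rangle_{\mathscr{C}_0}=\int_Yf(u)\overline{G(u)}\,d\omega(u)$, where $G=\lim_{r\to 1}G_r$ is obtained from $g$ as $F$ from $f$; $\mathcal{N}=\{f\in\mathscr{C}_0:\langle f,f\rangle_{\mathscr{C}_0}=0\}$. $H$ acts on $\mathscr{C}_0$, preserving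 the form, by $\tau(h)f(\eta)=J_{h^{-1}}(\eta)^\beta f(h^{-1}\eta)$, $\beta=\frac{n-2}{n+m}$. When $n-m>2$ the constant function $1$ belongs to $\mathscr{C}_0$. $H\cdot1$ is the set of all finite linear combinations of the functions $\tau(h)1$, $h\in H$; $\mathcal{N}_{H\cdot1}=\mathcal{N}\cap H\cdot1$; $\mathcal{H}$ is the Hilbert space completion of $H\cdot1/\mathcal{N}_{H\cdot1}$; and $\tau$ also denotes the unitary representation of $H$ on $\mathcal{H}$ obtained by restricting to $H\cdot1$, passing to the quotient, and extending to the completion. *)

theory Defs
  imports "HOL-Analysis.Analysis"
begin

section \<open>The group, its action and the invariant measure\<close>

text \<open>
  With \<open>n = CARD('n)\<close> and \<open>m = CARD('m)\<close>, an \<open>n \<times> m\<close> matrix has type \<open>real^'m^'n\<close>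
  and an \<open>(n+m) \<times> (n+m)\<close> matrix has type \<open>real^('n+'m)^('n+'m)\<close>; the summand \<open>Inl\<close>
  carries the first \<open>n\<close> coordinates, \<open>Inr\<close> the last \<open>m\<close>.
\<close>

definition blockA :: "real^('n::finite+'m::finite)^('n+'m) \<Rightarrow> real^'n^'n" where
  "blockA h = (\<chi> i j. h $ Inl i $ Inl j)"

definition blockB :: "real^('n::finite+'m::finite)^('n+'m) \<Rightarrow> real^'m^'n" where
  "blockB h = (\<chi> i j. h $ Inl i $ Inr j)"

definition blockC :: "real^('n::finite+'m::finite)^('n+'m) \<Rightarrow> real^'n^'m" where
  "blockC h = (\<chi> i j. h $ Inr i $ Inl j)"

definition blockD :: "real^('n::finite+'m::finite)^('n+'m) \<Rightarrow> real^'m^'m" where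
  "blockD h = (\<chi> i j. h $ Inr i $ Inr j)"

definition indef_form :: "real^('n::finite+'m::finite) \<Rightarrow> real^('n+'m) \<Rightarrow> real" where
  "indef_form u v = (\<Sum>i\<in>UNIV. u $ Inl i * v $ Inl i) - (\<Sum>j\<in>UNIV. u $ Inr j * v $ Inr j)"

definition SO_group :: "(real^('n::finite+'m::finite)^('n+'m)) set" where
  "SO_group = {h. det h = 1 \<and> (\<forall>u v. indef_form (h *v u) (h *v v) = indef_form u v)}"

definition L_group :: "(real^('n::finite+'m::finite)^('n+'m)) set" where
  "L_group = {h \<in> SO_group. blockB h = 0 \<and> blockC h = 0}"

definition stiefel :: "(real^'m::finite^'n::finite) set" where
  "stiefel = {v. transpose v ** v = mat 1}"

definition act :: "real^('n::finite+'m::finite)^('n+'m) \<Rightarrow> real^'m^'n \<Rightarrow> real^'m^'n" where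
  "act h v = (blockA h ** v + blockB h) ** matrix_inv (blockC h ** v + blockD h)"

text \<open>\<open>J_pow h s v\<close> is the real power \<open>J\<^sub>h(v)\<^sup>s\<close> of the modulus of
  \<open>J\<^sub>h(v) = det (Cv + D)\<close> to the \<open>-(n+m)\<close>.\<close>

definition J_pow :: "real^('n::finite+'m::finite)^('n+'m) \<Rightarrow> real \<Rightarrow> real^'m^'n \<Rightarrow> real" where
  "J_pow h s v = \<bar>det (blockC h ** v + blockD h)\<bar> powr (- s * real (CARD('n) + CARD('m)))"

definition normalised_invariant_measure :: "(real^'m::finite^'n::finite) measure \<Rightarrow> bool" where
  "normalised_invariant_measure \<omega> \<longleftrightarrow>
     sets \<omega> = sets (restrict_space borel stiefel) \<and>
     emeasure \<omega> (space \<omega>) = 1 \<and>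
     (\<forall>l\<in>L_group. distr \<omega> \<omega> (act l) = \<omega>)"


section \<open>The function space, the form and the action on functions\<close>

text \<open>Functions \<open>Y \<rightarrow> \<complex>\<close> are represented by total functions that vanish outside \<open>Y = stiefel\<close>.\<close>

definition F_fun ::
  "(real^'m::finite^'n::finite) measure \<Rightarrow> (real^'m^'n \<Rightarrow> complex) \<Rightarrow> real \<Rightarrow> real^'m^'n \<Rightarrow> complex" where
  "F_fun \<omega> f r u =
     (LINT v|\<omega>. f v * complex_of_real (inverse (det (mat 1 - r *\<^sub>R (u ** transpose v)))))"

definition F_lim ::
  "(real^'m::finite^'n::finite) measure \<Rightarrow> (real^'m^'n \<Rightarrow> complex) \<Rightarrow> real^'m^'n \<Rightarrow> complex" where
  "F_lim \<omega> f u = Lim (at_left 1) (\<lambda>r. F_fun \<omega> f r u)"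

definition C0 :: "(real^'m::finite^'n::finite) measure \<Rightarrow> (real^'m^'n \<Rightarrow> complex) set" where
  "C0 \<omega> = {f. (\<forall>v. v \<notin> stiefel \<longrightarrow> f v = 0) \<and> continuous_on stiefel f \<and>
              (\<exists>F. uniform_limit stiefel (F_fun \<omega> f) F (at_left 1))}"

definition C0_form ::
  "(real^'m::finite^'n::finite) measure \<Rightarrow> (real^'m^'n \<Rightarrow> complex) \<Rightarrow> (real^'m^'n \<Rightarrow> complex) \<Rightarrow> complex" where
  "C0_form \<omega> f g = (LINT u|\<omega>. f u * cnj (F_lim \<omega> g u))"

definition null_space :: "(real^'m::finite^'n::finite) measure \<Rightarrow> (real^'m^'n \<Rightarrow> complex) set" where
  "null_space \<omega> = {f \<in> C0 \<omega>. C0_form \<omega> f f = 0}"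

definition tau ::
  "real^('n::finite+'m::finite)^('n+'m) \<Rightarrow> (real^'m^'n \<Rightarrow> complex) \<Rightarrow> real^'m^'n \<Rightarrow> complex" where
  "tau h f \<eta> =
     (let \<beta> = (real CARD('n) - 2) / (real CARD('n) + real CARD('m)) in
      if \<eta> \<in> stiefel then complex_of_real (J_pow (matrix_inv h) \<beta> \<eta>) * f (act (matrix_inv h) \<eta>) else 0)"

definition const_one :: "real^'m::finite^'n::finite \<Rightarrow> complex" where
  "const_one v = (if v \<in> stiefel then 1 else 0)"

definition H_one :: "(real^'m::finite^'n::finite \<Rightarrow> complex) set" where
  "H_one = {f. \<exists>S c. finite S \<and> S \<subseteq> (SO_group :: (real^('n+'m)^('n+'m)) set) \<and>
                      f = (\<lambda>\<eta>. \<Sum>h\<in>S. c h * tau h const_one \<eta>)}"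


section \<open>Complex Hilbert spaces and completions\<close>

text \<open>The inner product is linear in its first argument.\<close>

class complex_hilbert_space = banach +
  fixes scaleC :: "complex \<Rightarrow> 'a \<Rightarrow> 'a" (infixr "*\<^sub>C" 75)
    and cinner :: "'a \<Rightarrow> 'a \<Rightarrow> complex"
  assumes scaleC_add_right: "c *\<^sub>C (x + y) = c *\<^sub>C x + c *\<^sub>C y"
    and scaleC_add_left: "(c + d) *\<^sub>C x = c *\<^sub>C x + d *\<^sub>C x"
    and scaleC_scaleC: "c *\<^sub>C d *\<^sub>C x = (c * d) *\<^sub>C x"
    and scaleC_of_real: "complex_of_real r *\<^sub>C x = r *\<^sub>R x"
    and cinner_commute: "cinner x y = cnj (cinner y x)"
    and cinner_add_left: "cinner (x + y) z = cinner x z + cinner y z"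
    and cinner_scaleC_left: "cinner (c *\<^sub>C x) y = c * cinner x y"
    and cinner_self: "cinner x x = complex_of_real ((norm x)\<^sup>2)"

text \<open>
  \<open>\<iota>\<close> exhibits the Hilbert space \<open>'k\<close> as the completion of \<open>V / N\<close> for the form \<open>B\<close>: it
  is a linear map on \<open>V\<close> that factors through an injective isometric map on \<open>V / N\<close>
  with dense range. This determines \<open>('k, \<iota>)\<close> up to unique unitary isomorphism.
\<close>

definition hilbert_completion ::
  "('a \<Rightarrow> complex) set \<Rightarrow> ('a \<Rightarrow> complex) set \<Rightarrow> (('a \<Rightarrow> complex) \<Rightarrow> ('a \<Rightarrow> complex) \<Rightarrow> complex)
     \<Rightarrow> (('a \<Rightarrow> complex) \<Rightarrow> 'k::complex_hilbert_space) \<Rightarrow> bool" where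
  "hilbert_completion V N B \<iota> \<longleftrightarrow>
     (\<forall>f\<in>V. \<forall>g\<in>V. \<iota> (\<lambda>x. f x + g x) = \<iota> f + \<iota> g) \<and>
     (\<forall>c. \<forall>f\<in>V. \<iota> (\<lambda>x. c * f x) = c *\<^sub>C \<iota> f) \<and>
     (\<forall>f\<in>V. \<forall>g\<in>V. \<iota> f = \<iota> g \<longleftrightarrow> (\<lambda>x. f x - g x) \<in> N) \<and>
     (\<forall>f\<in>V. \<forall>g\<in>V. cinner (\<iota> f) (\<iota> g) = B f g) \<and>
     closure (\<iota> ` V) = UNIV"


section \<open>Unitary representations\<close>

definition unitary_operator :: "('k::complex_hilbert_space \<Rightarrow> 'k) \<Rightarrow> bool" where
  "unitary_operator U \<longleftrightarrow>
     (\<forall>x y. U (x + y) = U x + U y) \<and> (\<forall>c x. U (c *\<^sub>C x) = c *\<^sub>C U x) \<and>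
     (\<forall>x y. cinner (U x) (U y) = cinner x y) \<and> surj U"

text \<open>Strong continuity is not part of this definition.\<close>

definition unitary_representation ::
  "(real^'a::finite^'a) set \<Rightarrow> (real^'a^'a \<Rightarrow> 'k::complex_hilbert_space \<Rightarrow> 'k) \<Rightarrow> bool" where
  "unitary_representation G \<pi> \<longleftrightarrow>
     (\<forall>g\<in>G. unitary_operator (\<pi> g)) \<and> \<pi> (mat 1) = id \<and>
     (\<forall>g\<in>G. \<forall>h\<in>G. \<pi> (g ** h) = \<pi> g \<circ> \<pi> h)"

definition closed_csubspace :: "'k::complex_hilbert_space set \<Rightarrow> bool" where
  "closed_csubspace W \<longleftrightarrow>
     closed W \<and> 0 \<in> W \<and> (\<forall>x\<in>W. \<forall>y\<in>W. x + y \<in> W) \<and> (\<forall>c. \<forall>x\<in>W. c *\<^sub>C x \<in> W)"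

definition irreducible_representation ::
  "(real^'a::finite^'a) set \<Rightarrow> (real^'a^'a \<Rightarrow> 'k::complex_hilbert_space \<Rightarrow> 'k) \<Rightarrow> bool" where
  "irreducible_representation G \<pi> \<longleftrightarrow>
     (UNIV :: 'k set) \<noteq> {0} \<and>
     (\<forall>W. closed_csubspace W \<and> (\<forall>g\<in>G. \<pi> g ` W \<subseteq> W) \<longrightarrow> W = {0} \<or> W = UNIV)"

end

theory Submission
  imports Defs "HOL-Probability.Probability_Measure"
begin

text \<open>
  The vector \<open>e = \<iota> 1\<close> is cyclic and fixed by the rotations \<open>diag(A, 1)\<close>. As these act
  transitively and isometrically on the compact space \<open>Y\<close>, iterated finite averages of a
  continuous function over suitable rotations come uniformly close to a constant. On the side of
  the Hilbert space this says that averaging \<open>w\<close> over rotations approximates its orthogonal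
  projection to the line of \<open>e\<close>. So a closed invariant subspace \<open>W \<noteq> 0\<close> contains the projection
  of each of its vectors; since \<open>e\<close> is cyclic some translate of a vector of \<open>W\<close> has a nonzero
  projection, hence \<open>e \<in> W\<close> and \<open>W\<close> is everything.
\<close>

section \<open>Complex inner products\<close>

text \<open>Strong continuity is not part of \<open>unitary_representation\<close>, so orbits cannot
  be integrated over the compact group. Finite averages need only linearity, and they stay in an
  invariant subspace before any limit is taken. Two obstacles shape the rest. Uniform closeness does
  not by itself give closeness in the Hilbert norm: the form satisfies |<f,g>| \<le> K sup|f| with a
  K that depends on \<open>g\<close>. For the error \<open>d\<close> of an average, <d,d> would call
  for the K of \<open>d\<close> itself. Expanding the second \<open>d\<close> and moving the
  rotations to the first argument leaves only the constants of the original function and of 1. The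
  other obstacle is that \<open>C0_form\<close> is an integral against a limit, and either may be a
  default value. The bound is therefore proved by cases, and \<open>e\<close> is shown to be nonzero
  through the positivity of the kernel for r < 1, from which the limit for the constant function
  inherits a positive lower bound.\<close>

context complex_hilbert_space begin

lemma cinner_add_right: "cinner x (y + z) = cinner x y + cinner x z"
  by (metis cinner_commute cinner_add_left complex_cnj_add)

lemma cinner_scaleC_right: "cinner x (c *\<^sub>C y) = cnj c * cinner x y"
  by (metis cinner_commute cinner_scaleC_left complex_cnj_mult)

end

lemma scaleC_minus1: "(-1) *\<^sub>C (x::'k::complex_hilbert_space) = - x"
  using scaleC_of_real[of "-1" x] by simp

lemma scaleC_one: "1 *\<^sub>C (x::'k::complex_hilbert_space) = x"
  using scaleC_of_real[of 1 x] by simp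

lemma scaleC_zero_left: "0 *\<^sub>C (x::'k::complex_hilbert_space) = 0"
  using scaleC_of_real[of 0 x] by simp

lemma scaleC_zero_right: "c *\<^sub>C (0::'k::complex_hilbert_space) = 0"
  using scaleC_add_right[of c 0 0] by simp

lemma scaleC_diff_right: "c *\<^sub>C (x - y) = c *\<^sub>C x - c *\<^sub>C (y::'k::complex_hilbert_space)"
  using scaleC_add_right[of c "x - y" y] by (simp add: algebra_simps)

lemma scaleC_sum_right:
  "c *\<^sub>C (\<Sum>i\<in>I. x i) = (\<Sum>i\<in>I. c *\<^sub>C (x i :: 'k::complex_hilbert_space))"
  by (induction I rule: infinite_finite_induct) (auto simp: scaleC_zero_right scaleC_add_right)

lemma cinner_minus_left: "cinner (- x) (y::'k::complex_hilbert_space) = - cinner x y"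
  by (metis cinner_scaleC_left mult_minus1 scaleC_minus1)

lemma cinner_minus_right: "cinner x (- y) = - cinner x (y::'k::complex_hilbert_space)"
  by (metis cinner_minus_left cinner_commute complex_cnj_minus)

lemma cinner_diff_left: "cinner (x - z) (y::'k::complex_hilbert_space) = cinner x y - cinner z y"
  using cinner_add_left[of x "-z" y] by (simp add: cinner_minus_left)

lemma cinner_diff_right: "cinner x (y - z) = cinner x y - cinner x (z::'k::complex_hilbert_space)"
  using cinner_add_right[of x y "-z"] by (simp add: cinner_minus_right)

lemma cinner_zero_left: "cinner 0 (y::'k::complex_hilbert_space) = 0"
  using cinner_diff_left[of 0 0 y] by simp

lemma cinner_zero_right: "cinner y (0::'k::complex_hilbert_space) = 0"
  using cinner_diff_right[of y 0 0] by simp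

lemma cinner_sum_left:
  "cinner (\<Sum>i\<in>I. x i) (y::'k::complex_hilbert_space) = (\<Sum>i\<in>I. cinner (x i) y)"
  by (induction I rule: infinite_finite_induct) (auto simp: cinner_zero_left cinner_add_left)

lemma cinner_sum_right:
  "cinner y (\<Sum>i\<in>I. x i) = (\<Sum>i\<in>I. cinner y (x i :: 'k::complex_hilbert_space))"
  by (induction I rule: infinite_finite_induct) (auto simp: cinner_zero_right cinner_add_right)

lemma norm_scaleC: "norm (c *\<^sub>C (x::'k::complex_hilbert_space)) = cmod c * norm x"
proof -
  have "cinner (c *\<^sub>C x) (c *\<^sub>C x) = (c * cnj c) * cinner x x"
    by (simp add: cinner_scaleC_left cinner_scaleC_right)
  then have "complex_of_real ((norm (c *\<^sub>C x))\<^sup>2) = complex_of_real ((cmod c * norm x)\<^sup>2)"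
    by (simp add: cinner_self power_mult_distrib complex_norm_square[unfolded of_real_power] mult.commute)
  then have "(norm (c *\<^sub>C x))\<^sup>2 = (cmod c * norm x)\<^sup>2"
    using of_real_eq_iff by blast
  then show ?thesis
    by (rule power2_eq_imp_eq) auto
qed

lemma cinner_Cauchy_Schwarz: "cmod (cinner x y) \<le> norm x * norm (y::'k::complex_hilbert_space)"
proof (cases "y = 0")
  case False
  define c where "c = cinner x y / cinner y y"
  have ny: "norm y > 0" "cinner y y \<noteq> 0"
    using False by (auto simp: cinner_self)
  have orth: "cinner (x - c *\<^sub>C y) y = 0"
    using ny by (simp add: cinner_diff_left cinner_scaleC_left c_def)
  have "cinner (x - c *\<^sub>C y) (x - c *\<^sub>C y) = cinner x x - cnj c * cinner x y"
    by (smt (verit) orth cinner_diff_left cinner_diff_right cinner_scaleC_left cinner_scaleC_right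
        cinner_commute complex_cnj_zero diff_zero mult_zero_right complex_cnj_mult complex_cnj_cnj)
  also have "cnj c * cinner x y = complex_of_real ((cmod (cinner x y))\<^sup>2 / (norm y)\<^sup>2)"
    by (simp add: c_def cinner_self complex_norm_square[unfolded of_real_power])
  finally have "complex_of_real ((norm (x - c *\<^sub>C y))\<^sup>2)
      = complex_of_real ((norm x)\<^sup>2 - (cmod (cinner x y))\<^sup>2 / (norm y)\<^sup>2)"
    by (simp add: cinner_self)
  then have "(norm x)\<^sup>2 - (cmod (cinner x y))\<^sup>2 / (norm y)\<^sup>2 \<ge> 0"
    by (metis of_real_eq_iff zero_le_power2)
  then have "(cmod (cinner x y))\<^sup>2 \<le> (norm x * norm y)\<^sup>2"
    using ny by (simp add: field_simps power_mult_distrib)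
  then show ?thesis
    by (rule power2_le_imp_le) simp
qed (simp add: cinner_zero_right)

section \<open>Orthogonal frames\<close>

text \<open>The reflection in the hyperplane orthogonal to \<open>a\<close>. Division by zero makes
  it the identity at \<open>a = 0\<close>, so it may be formed from a difference
  \<open>x - y\<close> that could vanish.\<close>

definition householder :: "real^'n \<Rightarrow> real^'n^'n" where
  "householder a = matrix (\<lambda>x. x - (2 * (a \<bullet> x) / (a \<bullet> a)) *\<^sub>R a)"

lemma householder_apply: "householder a *v x = x - (2 * (a \<bullet> x) / (a \<bullet> a)) *\<^sub>R (a::real^'n)"
proof -
  have "linear (\<lambda>x. x - (2 * (a \<bullet> x) / (a \<bullet> a)) *\<^sub>R a)"
    by (rule linearI) (auto simp: inner_add_right algebra_simps add_divide_distrib)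
  then show ?thesis
    by (simp add: householder_def matrix_works)
qed

lemma householder_fixes: "a \<bullet> x = 0 \<Longrightarrow> householder a *v x = x"
  by (simp add: householder_apply)

text \<open>For equal norms \<open>2 * ((x - y) \<bullet> x)\<close> is the square of the norm of
  \<open>x - y\<close>, so the coefficient in the reflection is one and exactly \<open>x - y\<close>
  is subtracted.\<close>

lemma householder_swaps:
  assumes "norm x = norm (y::real^'n)"
  shows "householder (x - y) *v x = y"
proof (cases "x = y")
  case False
  have "x \<bullet> x = y \<bullet> y"
    using assms by (simp add: norm_eq)
  then have "2 * ((x - y) \<bullet> x) = (x - y) \<bullet> (x - y)"
    by (simp add: inner_diff_left inner_diff_right inner_commute)
  moreover have "(x - y) \<bullet> (x - y) \<noteq> 0"
    using False by simp
  ultimately show ?thesis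
    by (simp add: householder_apply)
qed (simp add: householder_apply)

lemma orthogonal_matrix_inner:
  "orthogonal_matrix A \<Longrightarrow> (A *v x) \<bullet> (A *v y) = x \<bullet> (y :: real^'n)"
  using orthogonal_transformation_matrix[of "(*v) A"]
  by (simp add: orthogonal_transformation_def matrix_vector_mul_linear)

lemma orthogonal_matrix_householder: "orthogonal_matrix (householder (a::real^'n))"
proof -
  have "(householder a *v x) \<bullet> (householder a *v x) = x \<bullet> x" for x
    by (cases "a = 0")
       (auto simp: householder_apply inner_diff_left inner_diff_right inner_commute field_simps)
  then have "orthogonal_transformation (\<lambda>x. householder a *v x)"
    by (simp add: orthogonal_transformation norm_eq matrix_vector_mul_linear)
  then show ?thesis
    by (simp add: orthogonal_transformation_matrix)
qed

section \<open>Elements of the Stiefel manifold as orthonormal systems of columns\<close>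

lemma inner_column: "column i v \<bullet> column j v = (transpose v ** v) $ i $ (j::'m::finite)"
  for v :: "real^'m^'n"
  by (simp add: inner_vec_def column_def matrix_matrix_mult_def transpose_def)

lemma stiefel_inner_column:
  "v \<in> stiefel \<Longrightarrow> column i v \<bullet> column j v = (if i = (j::'m::finite) then 1 else 0)"
  for v :: "real^'m^'n"
  by (simp add: inner_column stiefel_def mat_def)

lemma column_matrix_mult: "column j (A ** v) = A *v column j v"
  for A :: "real^'n^'k" and v :: "real^'m^'n"
  by (simp add: vec_eq_iff column_def matrix_matrix_mult_def matrix_vector_mult_def)

lemma eq_columns: "(\<And>j. column j v = column j w) \<Longrightarrow> v = (w :: real^'m^'n)"
  by (simp add: vec_eq_iff column_def)

lemma orthogonal_mult_stiefel:
  "orthogonal_matrix A \<Longrightarrow> A ** v \<in> stiefel \<longleftrightarrow> v \<in> stiefel"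
  for A :: "real^'n^'n" and v :: "real^'m::finite^'n"
proof -
  assume A: "orthogonal_matrix A"
  have "transpose (A ** v) ** (A ** v) = transpose v ** (transpose A ** A) ** v"
    by (simp only: matrix_transpose_mul matrix_mul_assoc)
  also have "\<dots> = transpose v ** v"
    using A by (simp add: orthogonal_matrix)
  finally have "transpose (A ** v) ** (A ** v) = transpose v ** v" .
  then show ?thesis
    by (simp add: stiefel_def)
qed

text \<open>The columns are matched one at a time. The reflection that carries the next column of
  \<open>A ** v\<close> to that of \<open>w\<close> leaves the matched columns in place, because
  both vectors that it exchanges are orthogonal to them.\<close>

lemma orthogonal_matrix_moves_frame:
  fixes v w :: "real^'m::finite^'n::finite"
  assumes v: "v \<in> stiefel" and w: "w \<in> stiefel"
  shows "\<exists>A. orthogonal_matrix A \<and> A ** v = w"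
proof -
  have "\<exists>A. orthogonal_matrix A \<and> (\<forall>j\<in>J. A *v column j v = column j w)" for J :: "'m set"
  proof (induction J rule: infinite_finite_induct)
    case (insert k J)
    then obtain A where A: "orthogonal_matrix A" "\<forall>j\<in>J. A *v column j v = column j w"
      by blast
    define x where "x = A *v column k v"
    define y where "y = column k w"
    have Av: "A ** v \<in> stiefel"
      using A(1) v orthogonal_mult_stiefel by blast
    have "x \<bullet> x = y \<bullet> y"
      using stiefel_inner_column[OF Av, of k k] stiefel_inner_column[OF w, of k k]
      by (simp add: x_def y_def column_matrix_mult)
    then have nxy: "norm x = norm y"
      by (simp add: norm_eq)
    have "(x - y) \<bullet> column j w = 0" if "j \<in> J" for j
    proof -
      have "k \<noteq> j"
        using that insert by blast
      then show ?thesis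
        using stiefel_inner_column[OF Av, of k j] stiefel_inner_column[OF w, of k j] A(2) that
        by (simp add: x_def y_def column_matrix_mult inner_diff_left)
    qed
    then have "\<forall>j\<in>insert k J. (householder (x - y) ** A) *v column j v = column j w"
      using A(2) householder_swaps[OF nxy]
      by (auto simp: householder_fixes x_def y_def simp flip: matrix_vector_mul_assoc)
    then show ?case
      using orthogonal_matrix_mul[OF orthogonal_matrix_householder A(1)] by blast
  qed (auto intro!: exI[of _ "mat 1"] simp: orthogonal_matrix_id)
  from this[of UNIV] show ?thesis
    by (metis UNIV_I column_matrix_mult eq_columns)
qed

section \<open>Rotations inside the group\<close>

definition embed :: "real^'n^'n \<Rightarrow> real^('n::finite+'m::finite)^('n+'m)" where
  "embed A = (\<chi> i j. case (i, j) of (Inl a, Inl b) \<Rightarrow> A $ a $ b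
     | (Inr a, Inr b) \<Rightarrow> (if a = b then 1 else 0) | _ \<Rightarrow> 0)"

lemma embed_simps [simp]:
  "embed A $ Inl a $ Inl b = A $ a $ b"
  "embed A $ Inr c $ Inr d = (if c = d then 1 else 0)"
  "embed A $ Inl a $ Inr d = 0"
  "embed A $ Inr c $ Inl b = 0"
  by (simp_all add: embed_def)

lemma sum_UNIV_Plus:
  "(\<Sum>i\<in>(UNIV::('n::finite+'m::finite) set). g i) = (\<Sum>i\<in>UNIV. g (Inl i)) + (\<Sum>i\<in>UNIV. g (Inr i))"
  for g :: "_ \<Rightarrow> 'a::comm_monoid_add"
  unfolding UNIV_Plus_UNIV[symmetric] by (subst sum.Plus) auto

lemma all_Plus: "(\<forall>i::'n+'m. P i) \<longleftrightarrow> (\<forall>a. P (Inl a)) \<and> (\<forall>b. P (Inr b))"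
  by (metis sum.exhaust)

lemma embed_mult: "embed (A ** B) = embed A ** embed B"
  by (simp add: vec_eq_iff all_Plus matrix_matrix_mult_def sum_UNIV_Plus if_distrib cong: if_cong)

lemma embed_id: "embed (mat 1) = mat 1"
  by (simp add: vec_eq_iff all_Plus mat_def)

lemma transpose_embed: "transpose (embed A) = embed (transpose A)"
  by (auto simp: vec_eq_iff all_Plus transpose_def)

lemma orthogonal_matrix_embed: "orthogonal_matrix A \<Longrightarrow> orthogonal_matrix (embed A)"
  by (metis embed_id embed_mult orthogonal_matrix_def transpose_embed)

text \<open>Taking the determinant after the embedding spares the formula for block determinants.\<close>

definition rotations :: "'m::finite itself \<Rightarrow> (real^'n::finite^'n) set" where
  "rotations _ = {A. orthogonal_matrix A \<and> det (embed A :: real^('n+'m)^('n+'m)) = 1}"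

lemma embed_vector_mult:
  "(embed A *v u) $ Inl i = (A *v (\<chi> k. u $ Inl k)) $ i"
  "(embed A *v u) $ Inr j = u $ Inr j"
  by (simp_all add: matrix_vector_mult_def sum_UNIV_Plus if_distrib[of "\<lambda>x. x * _"] cong: if_cong)

lemma embed_in_SO_group:
  assumes "A \<in> rotations TYPE('m)"
  shows "(embed A :: real^('n::finite+'m::finite)^('n+'m)) \<in> SO_group"
proof -
  have "(A *v x) \<bullet> (A *v y) = x \<bullet> y" for x y
    using assms by (simp add: rotations_def orthogonal_matrix_inner)
  from this[unfolded inner_vec_def] have "indef_form (embed A *v u) (embed A *v v) = indef_form u v"
    for u v :: "real^('n::finite+'m::finite)"
    by (simp add: indef_form_def embed_vector_mult inner_real_def)
  then show ?thesis
    using assms by (simp add: SO_group_def rotations_def)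
qed

lemma transpose_rotation: "A \<in> rotations TYPE('m::finite) \<Longrightarrow> transpose A \<in> rotations TYPE('m)"
  by (simp add: rotations_def orthogonal_matrix_transpose flip: transpose_embed)

text \<open>Reflections are conjugate under orthogonal matrices, and conjugation survives the
  embedding. This reduces the claim to a vector on a coordinate axis, where the matrix is diagonal
  with a single entry -1.\<close>

lemma det_embed_householder:
  assumes "a \<noteq> (0::real^'n)"
  shows "det (embed (householder a) :: real^('n::finite+'m::finite)^('n+'m)) = -1"
proof -
  obtain k :: 'n where True by blast
  \<comment> \<open>The length of \<open>b\<close> is that of \<open>a\<close>, so that
    \<open>Q\<close> sends \<open>b\<close> to \<open>a\<close> itself and the two reflection
    formulas match term by term.\<close>
  define b where "b = norm a *\<^sub>R (axis k 1 :: real^'n)"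
  obtain Q where Q: "orthogonal_matrix Q" "Q *v axis k 1 = a /\<^sub>R norm a"
    using orthogonal_matrix_exists_basis[of "a /\<^sub>R norm a" k] assms by auto
  have Qb: "Q *v b = a"
    using Q(2) assms by (simp add: b_def matrix_vector_mult_scaleR)
  have ip: "(Q *v x) \<bullet> (Q *v y) = x \<bullet> y" for x y
    using Q(1) by (rule orthogonal_matrix_inner)
  have "(householder a ** Q) *v x = (Q ** householder b) *v x" for x
    using ip[of b x] ip[of b b] Qb
    by (simp add: householder_apply matrix_vector_mult_diff_distrib matrix_vector_mult_scaleR
        flip: matrix_vector_mul_assoc)
  then have "householder a ** Q = Q ** householder b"
    using matrix_eq by blast
  then have "det (embed (householder a) :: real^('n+'m)^('n+'m)) * det (embed Q :: real^('n+'m)^('n+'m))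
      = det (embed Q :: real^('n+'m)^('n+'m)) * det (embed (householder b) :: real^('n+'m)^('n+'m))"
    by (metis det_mul embed_mult)
  moreover have "det (embed Q :: real^('n+'m)^('n+'m)) \<noteq> 0"
  proof -
    have "orthogonal_matrix (embed Q :: real^('n+'m)^('n+'m))"
      by (rule orthogonal_matrix_embed) (rule Q(1))
    then show ?thesis
      using det_orthogonal_matrix by force
  qed
  moreover have "det (embed (householder b) :: real^('n+'m)^('n+'m)) = -1"
  proof -
    have bb: "b \<bullet> b = (norm a)\<^sup>2"
      by (simp add: dot_square_norm b_def)
    have b_nth: "b $ i = (if i = k then norm a else 0)" for i
      by (simp add: b_def axis_def)
    have b_axis: "b \<bullet> axis j 1 = (if j = k then norm a else 0)" for j
      by (simp add: inner_axis b_nth)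
    have hb: "householder b $ i $ j = (if i = j then (if i = k then -1 else 1) else 0)" for i j
    proof -
      have "householder b $ i $ j = (householder b *v axis j 1) $ i"
        by (simp add: matrix_vector_mul_component inner_axis)
      also have "\<dots> = (if i = j then (if i = k then -1 else 1) else 0)"
        using assms bb by (auto simp: householder_apply b_axis b_nth power2_eq_square) (auto simp: axis_def)
      finally show ?thesis .
    qed
    then have "det (embed (householder b) :: real^('n+'m)^('n+'m))
        = (\<Prod>i\<in>UNIV. (embed (householder b) :: real^('n+'m)^('n+'m)) $ i $ i)"
      by (intro det_diagonal) (rename_tac i j, case_tac i; case_tac j; simp)
    also have "\<dots> = (\<Prod>i\<in>(UNIV::('n+'m) set). if i = Inl k then -1 else 1)"
      using hb by (intro prod.cong refl) (rename_tac i, case_tac i, auto)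
    also have "\<dots> = -1"
      by (simp add: prod.delta)
    finally show ?thesis .
  qed
  ultimately have "det (embed (householder a) :: real^('n+'m)^('n+'m)) * det (embed Q :: real^('n+'m)^('n+'m))
      = -1 * det (embed Q :: real^('n+'m)^('n+'m))"
    by simp
  then show ?thesis
    using \<open>det (embed Q) \<noteq> 0\<close> by (simp only: mult_cancel_right) simp
qed

text \<open>Only a determinant -1 has to be repaired. As the \<open>m\<close> columns of
  \<open>w\<close> cannot span a space of dimension \<open>n > m\<close>, some nonzero
  \<open>a\<close> is orthogonal to all of them; the reflection along \<open>a\<close> fixes
  \<open>w\<close> and changes the sign.\<close>

lemma rotations_transitive:
  fixes v w :: "real^'m::finite^'n::finite"
  assumes "CARD('m) < CARD('n)" "v \<in> stiefel" "w \<in> stiefel"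
  shows "\<exists>A\<in>rotations TYPE('m). A ** v = w"
proof -
  obtain A where A: "orthogonal_matrix A" "A ** v = w"
    using orthogonal_matrix_moves_frame assms by blast
  consider "det (embed A :: real^('n+'m)^('n+'m)) = 1" | "det (embed A :: real^('n+'m)^('n+'m)) = -1"
    using det_orthogonal_matrix[OF orthogonal_matrix_embed[OF A(1)]] by blast
  then show ?thesis
  proof cases
    case 2
    have cols: "columns w = (\<lambda>j. column j w) ` UNIV"
      by (auto simp: columns_def)
    then have "dim (columns w) \<le> card (columns w)"
      by (simp add: dim_le_card')
    also from cols have "card (columns w) \<le> CARD('m)"
      by (simp add: card_image_le)
    finally obtain a where a: "a \<noteq> 0" "\<And>y. y \<in> span (columns w) \<Longrightarrow> orthogonal a y"
      using orthogonal_to_subspace_exists[of "columns w"] assms(1) by auto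
    have "householder a *v column j w = column j w" for j
      using a(2)[OF span_base] cols by (simp add: orthogonal_def householder_fixes)
    then have "(householder a ** A) ** v = w"
      using A(2) by (metis column_matrix_mult eq_columns matrix_mul_assoc)
    moreover have "householder a ** A \<in> rotations TYPE('m)"
      using A(1) 2 det_embed_householder[OF a(1), where ?'m='m]
      by (simp add: rotations_def orthogonal_matrix_mul orthogonal_matrix_householder embed_mult det_mul)
    ultimately show ?thesis by blast
  qed (use A in \<open>auto simp: rotations_def\<close>)
qed

text \<open>The norm of the matrix type is assembled from rows; \<open>sq\<close> regroups it by
  columns, on each of which \<open>A\<close> acts isometrically.\<close>

lemma norm_orthogonal_mult:
  fixes v :: "real^'m::finite^'n::finite"
  assumes "orthogonal_matrix A"
  shows "norm (A ** v) = norm v"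
proof -
  have sq: "x \<bullet> x = (\<Sum>j\<in>UNIV. column j x \<bullet> column j x)" for x :: "real^'m^'n"
    by (simp add: inner_vec_def column_def) (rule sum.swap)
  have "(A *v x) \<bullet> (A *v x) = x \<bullet> x" for x
    using assms by (rule orthogonal_matrix_inner)
  then have "(A ** v) \<bullet> (A ** v) = v \<bullet> v"
    by (simp add: sq column_matrix_mult)
  then show ?thesis by (simp add: norm_eq)
qed

section \<open>The cocycle and the orbit of the constant function\<close>

text \<open>The point over \<open>x\<close> on the graph of \<open>v\<close>. The fractional linear
  action is the linear action of \<open>h\<close> on such graphs, and
  \<open>blockC h ** v + blockD h\<close> is the change of the parameter \<open>x\<close>.\<close>

definition graph_vec :: "real^'m^'n \<Rightarrow> real^'m \<Rightarrow> real^('n::finite+'m::finite)" where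
  "graph_vec v x = (\<chi> i. case i of Inl a \<Rightarrow> (v *v x) $ a | Inr b \<Rightarrow> x $ b)"

lemma block_mult_graph_vec:
  fixes h :: "real^('n::finite+'m::finite)^('n+'m)"
  shows "(\<chi> a. (h *v graph_vec v x) $ Inl a) = (blockA h ** v + blockB h) *v x"
    and "(\<chi> b. (h *v graph_vec v x) $ Inr b) = (blockC h ** v + blockD h) *v x"
proof -
  have "(\<chi> a. (h *v graph_vec v x) $ Inl a) = blockA h *v (v *v x) + blockB h *v x"
    by (simp add: vec_eq_iff blockA_def blockB_def matrix_vector_mult_def graph_vec_def sum_UNIV_Plus)
  then show "(\<chi> a. (h *v graph_vec v x) $ Inl a) = (blockA h ** v + blockB h) *v x"
    by (simp add: matrix_vector_mult_add_rdistrib matrix_vector_mul_assoc)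
  have "(\<chi> b. (h *v graph_vec v x) $ Inr b) = blockC h *v (v *v x) + blockD h *v x"
    by (simp add: vec_eq_iff blockC_def blockD_def matrix_vector_mult_def graph_vec_def sum_UNIV_Plus)
  then show "(\<chi> b. (h *v graph_vec v x) $ Inr b) = (blockC h ** v + blockD h) *v x"
    by (simp add: matrix_vector_mult_add_rdistrib matrix_vector_mul_assoc)
qed

lemma indef_form_blocks:
  "indef_form u v = (\<chi> a. u $ Inl a) \<bullet> (\<chi> a. v $ Inl a) - (\<chi> b. u $ Inr b) \<bullet> (\<chi> b. v $ Inr b)"
  by (simp add: indef_form_def inner_vec_def)

lemma stiefel_inner:
  fixes v :: "real^'m::finite^'n"
  shows "v \<in> stiefel \<longleftrightarrow> (\<forall>x y. (v *v x) \<bullet> (v *v y) = x \<bullet> y)"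
proof -
  have "(v *v x) \<bullet> (v *v y) = x \<bullet> ((transpose v ** v) *v y)" for x y
    by (simp add: dot_matrix_vector_mul flip: matrix_vector_mul_assoc)
       (metis dot_lmul_matrix transpose_matrix_vector transpose_transpose)
  then have "(\<forall>x y. (v *v x) \<bullet> (v *v y) = x \<bullet> y) \<longleftrightarrow> (\<forall>y. (transpose v ** v) *v y = y)"
    by (metis vector_eq_rdot inner_commute)
  also have "\<dots> \<longleftrightarrow> v \<in> stiefel"
    by (auto simp: stiefel_def matrix_eq)
  finally show ?thesis by simp
qed

text \<open>The columns of \<open>(v, 1)\<close> span an isotropic subspace, and \<open>h\<close> maps it to an isotropic subspace.\<close>

lemma SO_group_isotropic:
  fixes h :: "real^('n::finite+'m::finite)^('n+'m)" and v :: "real^'m^'n"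
  assumes "h \<in> SO_group" "v \<in> stiefel"
  shows "((blockA h ** v + blockB h) *v x) \<bullet> ((blockA h ** v + blockB h) *v y)
       = ((blockC h ** v + blockD h) *v x) \<bullet> ((blockC h ** v + blockD h) *v y)"
proof -
  have "indef_form (h *v graph_vec v x) (h *v graph_vec v y) = indef_form (graph_vec v x) (graph_vec v y)"
    using assms(1) by (simp add: SO_group_def)
  also have "\<dots> = (v *v x) \<bullet> (v *v y) - x \<bullet> y"
    by (simp add: indef_form_blocks graph_vec_def)
  also have "\<dots> = 0"
    using assms(2) by (simp add: stiefel_inner)
  finally show ?thesis
    by (simp add: indef_form_blocks block_mult_graph_vec)
qed

lemma SO_group_invertible: "h \<in> SO_group \<Longrightarrow> invertible h"
  by (simp add: SO_group_def invertible_det_nz)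

lemma invertible_matrix_inv:
  "invertible A \<Longrightarrow> A ** matrix_inv A = mat 1" "invertible A \<Longrightarrow> matrix_inv A ** A = mat 1"
  unfolding matrix_inv_def invertible_def by (metis (mono_tags, lifting) someI_ex)+

lemma matrix_inv_unique: "A ** B = mat 1 \<Longrightarrow> matrix_inv A = (B :: real^'n^'n)"
  by (metis invertible_def invertible_matrix_inv(2) matrix_left_right_inverse matrix_mul_assoc
      matrix_mul_lid matrix_mul_rid)

text \<open>A kernel vector \<open>x\<close> of the lower block would, by isotropy and the
  definiteness of the Euclidean product, be killed by the upper block too. Then \<open>h\<close>
  annihilates the graph point over \<open>x\<close>, against invertibility.\<close>

lemma det_cocycle_nonzero:
  fixes h :: "real^('n::finite+'m::finite)^('n+'m)" and v :: "real^'m^'n"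
  assumes h: "h \<in> SO_group" and v: "v \<in> stiefel"
  shows "det (blockC h ** v + blockD h) \<noteq> 0"
proof
  assume "det (blockC h ** v + blockD h) = 0"
  then obtain x where x: "x \<noteq> 0" "(blockC h ** v + blockD h) *v x = 0"
    by (metis invertible_det_nz invertible_left_inverse matrix_left_invertible_ker)
  then have "(blockA h ** v + blockB h) *v x = 0"
    using SO_group_isotropic[OF h v, of x x] by simp
  with x(2) have z: "h *v graph_vec v x = 0"
    using block_mult_graph_vec[of h v x]
    by (simp add: vec_eq_iff all_Plus)
  have "graph_vec v x = matrix_inv h *v (h *v graph_vec v x)"
    using invertible_matrix_inv(2)[OF SO_group_invertible[OF h]] by (simp add: matrix_vector_mul_assoc)
  then have "graph_vec v x = 0"
    using z by simp
  then have "x = 0"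
    by (simp add: vec_eq_iff all_Plus graph_vec_def)
  with x(1) show False ..
qed

text \<open>In the isotropy identity, replacing \<open>x\<close> by its preimage under the lower
  block says precisely that \<open>act h v\<close> is isometric.\<close>

lemma act_stiefel:
  fixes h :: "real^('n::finite+'m::finite)^('n+'m)" and v :: "real^'m^'n"
  assumes h: "h \<in> SO_group" and v: "v \<in> stiefel"
  shows "act h v \<in> stiefel"
proof -
  let ?M = "blockC h ** v + blockD h"
  have "invertible ?M"
    using det_cocycle_nonzero[OF assms] by (simp add: invertible_det_nz)
  then have "?M *v (matrix_inv ?M *v x) = x" for x
    by (simp add: matrix_vector_mul_assoc invertible_matrix_inv(1))
  then show ?thesis
    unfolding stiefel_inner act_def matrix_vector_mul_assoc[symmetric]
    using SO_group_isotropic[OF assms] by metis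
qed

section \<open>Group laws and the translates of the constant function\<close>

lemma SO_group_mult: "g \<in> SO_group \<Longrightarrow> h \<in> SO_group \<Longrightarrow> g ** h \<in> SO_group"
  by (simp add: SO_group_def det_mul flip: matrix_vector_mul_assoc)

lemma SO_group_id: "mat 1 \<in> SO_group"
  by (simp add: SO_group_def)

lemma SO_group_inv:
  assumes "h \<in> SO_group"
  shows "matrix_inv h \<in> SO_group"
proof -
  note inv = invertible_matrix_inv[OF SO_group_invertible[OF assms]]
  have "det h * det (matrix_inv h) = 1"
    using inv(1) by (metis det_I det_mul)
  moreover have "indef_form (matrix_inv h *v u) (matrix_inv h *v v) = indef_form u v" for u v
  proof -
    have "indef_form (matrix_inv h *v u) (matrix_inv h *v v)
        = indef_form (h *v (matrix_inv h *v u)) (h *v (matrix_inv h *v v))"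
      using assms by (simp add: SO_group_def)
    then show ?thesis
      by (simp add: matrix_vector_mul_assoc inv(1))
  qed
  ultimately show ?thesis
    using assms by (simp add: SO_group_def)
qed

text \<open>Since the action preserves the Stiefel manifold, the constant contributes 1 and only the
  cocycle remains. So every translate of the constant is positive and continuous there.\<close>

lemma tau_const_one:
  fixes h :: "real^('n::finite+'m::finite)^('n+'m)"
  assumes "h \<in> SO_group"
  shows "tau h const_one \<eta> = (if \<eta> \<in> stiefel then
    complex_of_real (J_pow (matrix_inv h) ((real CARD('n) - 2) / (real CARD('n) + real CARD('m))) \<eta>) else 0)"
  using act_stiefel[OF SO_group_inv[OF assms]] by (simp add: tau_def const_one_def)

lemma tau_id_const_one: "tau (mat 1) const_one = (const_one :: real^'m::finite^'n::finite \<Rightarrow> complex)"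
proof -
  have "matrix_inv (mat 1 :: real^('n+'m)^('n+'m)) = mat 1"
    by (rule matrix_inv_unique) simp
  moreover have "blockC (mat 1 :: real^('n+'m)^('n+'m)) = 0" "blockD (mat 1 :: real^('n+'m)^('n+'m)) = mat 1"
    by (simp_all add: blockC_def blockD_def vec_eq_iff mat_def)
  ultimately show ?thesis
    by (simp add: fun_eq_iff tau_const_one[OF SO_group_id] const_one_def J_pow_def)
qed

lemma J_pow_pos: "h \<in> SO_group \<Longrightarrow> v \<in> stiefel \<Longrightarrow> J_pow h s v > 0"
  by (simp add: J_pow_def det_cocycle_nonzero)

section \<open>Continuity of the cocycle and compactness\<close>

lemma continuous_on_det:
  fixes f :: "'a::topological_space \<Rightarrow> real^'n::finite^'n"
  assumes "continuous_on S f"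
  shows "continuous_on S (\<lambda>x. det (f x))"
  unfolding det_def by (intro continuous_intros assms)

lemma continuous_on_matrix_mult:
  fixes f :: "'a::topological_space \<Rightarrow> real^'n::finite^'k::finite" and g :: "'a \<Rightarrow> real^'m::finite^'n"
  assumes "continuous_on S f" "continuous_on S g"
  shows "continuous_on S (\<lambda>x. f x ** g x)"
  unfolding matrix_matrix_mult_def by (intro continuous_intros assms)

lemma continuous_on_transpose:
  fixes f :: "'a::topological_space \<Rightarrow> real^'n::finite^'k::finite"
  assumes "continuous_on S f"
  shows "continuous_on S (\<lambda>x. transpose (f x))"
  unfolding transpose_def by (intro continuous_intros assms)

lemma continuous_on_J_pow: "h \<in> SO_group \<Longrightarrow> continuous_on stiefel (J_pow h s)"
  unfolding J_pow_def
  by (intro continuous_intros continuous_on_det continuous_on_matrix_mult) (simp add: det_cocycle_nonzero)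

lemma compact_stiefel: "compact (stiefel :: (real^'m::finite^'n::finite) set)"
proof -
  have "closed (stiefel :: (real^'m^'n) set)"
    unfolding stiefel_def
    by (intro closed_Collect_eq continuous_on_matrix_mult continuous_on_transpose continuous_intros)
  moreover have "norm v = sqrt CARD('m)" if "v \<in> stiefel" for v :: "real^'m^'n"
  proof -
    have "v \<bullet> v = (\<Sum>j\<in>UNIV. column j v \<bullet> column j v)"
      by (simp add: inner_vec_def column_def) (rule sum.swap)
    also have "\<dots> = CARD('m)"
      using that by (simp add: stiefel_inner_column)
    finally show ?thesis
      by (simp add: norm_eq_sqrt_inner)
  qed
  then have "bounded (stiefel :: (real^'m^'n) set)"
    by (metis boundedI order_refl)
  ultimately show ?thesis
    by (simp add: compact_eq_bounded_closed)
qed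

text \<open>On functions vanishing off the Stiefel manifold this is \<open>tau (embed A)\<close> for
  orthogonal \<open>A\<close>: the inverse is the transpose and the cocycle is 1. The form without
  cases makes averages easy to compute.\<close>

definition rot :: "real^'n^'n \<Rightarrow> (real^'m^'n \<Rightarrow> complex) \<Rightarrow> real^'m^'n \<Rightarrow> complex" where
  "rot A f = (\<lambda>\<eta>. f (transpose A ** \<eta>))"

text \<open>The cocycle identity for a block diagonal factor: multiplying the inverse of
  \<open>h\<close> on the right by \<open>embed (transpose A)\<close> turns its lower left block
  \<open>C\<close> into \<open>C ** transpose A\<close> and leaves the lower right block
  alone.\<close>

lemma rot_tau_const_one:
  fixes h :: "real^('n::finite+'m::finite)^('n+'m)"
  assumes A: "A \<in> rotations TYPE('m)" and h: "h \<in> SO_group"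
  shows "rot A (tau h const_one) = tau (embed A ** h) const_one"
proof
  fix \<eta> :: "real^'m^'n"
  have oA: "orthogonal_matrix A" and otA: "orthogonal_matrix (transpose A)"
    using A by (auto simp: rotations_def)
  have "A ** transpose A = mat 1"
    using oA by (simp add: orthogonal_matrix_def)
  then have "(embed A ** h) ** (matrix_inv h ** embed (transpose A)) = mat 1"
    by (metis SO_group_invertible embed_id embed_mult h invertible_matrix_inv(1) matrix_mul_assoc
        matrix_mul_rid)
  then have inv: "matrix_inv (embed A ** h) = matrix_inv h ** embed (transpose A)"
    by (rule matrix_inv_unique)
  have "blockC (matrix_inv h ** embed (transpose A)) = blockC (matrix_inv h) ** transpose A"
    by (simp add: blockC_def vec_eq_iff matrix_matrix_mult_def sum_UNIV_Plus)
  moreover have "blockD (matrix_inv h ** embed (transpose A)) = blockD (matrix_inv h)"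
    by (simp add: blockD_def vec_eq_iff matrix_matrix_mult_def sum_UNIV_Plus
        if_distrib[of "\<lambda>x. _ * x"] cong: if_cong)
  ultimately have "J_pow (matrix_inv (embed A ** h)) s \<eta> = J_pow (matrix_inv h) s (transpose A ** \<eta>)" for s
    by (simp add: J_pow_def inv matrix_mul_assoc)
  then show "rot A (tau h const_one) \<eta> = tau (embed A ** h) const_one \<eta>"
    using SO_group_mult[OF embed_in_SO_group[OF A] h] h otA
    by (simp add: rot_def tau_const_one orthogonal_mult_stiefel)
qed

lemma rot_const_one: "A \<in> rotations TYPE('m) \<Longrightarrow> rot A const_one = (const_one :: real^'m::finite^'n::finite \<Rightarrow> complex)"
  by (auto simp: rot_def const_one_def fun_eq_iff orthogonal_mult_stiefel rotations_def)

section \<open>The span of the orbit as a space of functions\<close>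

lemma tau_in_H_one:
  fixes h :: "real^('n::finite+'m::finite)^('n+'m)"
  assumes "h \<in> SO_group" shows "tau h const_one \<in> H_one"
  unfolding H_one_def using assms
  by (intro CollectI exI[of _ "{h}"] exI[of _ "\<lambda>_. 1"]) auto

lemma const_one_in_H_one: "(const_one :: real^'m::finite^'n::finite \<Rightarrow> complex) \<in> H_one"
  by (metis SO_group_id tau_id_const_one tau_in_H_one)

lemma H_one_scale:
  assumes "f \<in> H_one" shows "(\<lambda>x. c * f x) \<in> H_one"
proof -
  obtain S d where "finite S" "S \<subseteq> SO_group" "f = (\<lambda>\<eta>. \<Sum>h\<in>S. d h * tau h const_one \<eta>)"
    using assms unfolding H_one_def by blast
  then show ?thesis
    unfolding H_one_def
    by (intro CollectI exI[of _ S] exI[of _ "\<lambda>h. c * d h"]) (auto simp: sum_distrib_left mult.assoc)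
qed

lemma H_one_zero: "(\<lambda>_. 0) \<in> H_one"
  using H_one_scale[OF const_one_in_H_one, of 0] by simp

lemma H_one_add:
  assumes "f \<in> H_one" "g \<in> H_one" shows "(\<lambda>x. f x + g x) \<in> H_one"
proof -
  obtain S c where S: "finite S" "S \<subseteq> SO_group" "f = (\<lambda>\<eta>. \<Sum>h\<in>S. c h * tau h const_one \<eta>)"
    using assms(1) unfolding H_one_def by blast
  obtain T d where T: "finite T" "T \<subseteq> SO_group" "g = (\<lambda>\<eta>. \<Sum>h\<in>T. d h * tau h const_one \<eta>)"
    using assms(2) unfolding H_one_def by blast
  \<comment> \<open>A group element may occur in both expansions, so both coefficient families are
    extended by zero to the union and added there.\<close>
  define e where "e h = (if h \<in> S then c h else 0) + (if h \<in> T then d h else 0)" for h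
  have "(\<Sum>h\<in>S. c h * tau h const_one \<eta>) = (\<Sum>h\<in>S\<union>T. (if h \<in> S then c h else 0) * tau h const_one \<eta>)"
       "(\<Sum>h\<in>T. d h * tau h const_one \<eta>) = (\<Sum>h\<in>S\<union>T. (if h \<in> T then d h else 0) * tau h const_one \<eta>)" for \<eta>
    using S(1) T(1) by (auto intro!: sum.mono_neutral_cong_left)
  then have "(\<lambda>x. f x + g x) = (\<lambda>\<eta>. \<Sum>h\<in>S\<union>T. e h * tau h const_one \<eta>)"
    by (simp add: S T e_def sum.distrib distrib_right)
  with S T show ?thesis
    unfolding H_one_def by (intro CollectI exI[of _ "S\<union>T"] exI[of _ e]) auto
qed

lemma H_one_sum: "(\<And>i. i \<in> I \<Longrightarrow> f i \<in> H_one) \<Longrightarrow> (\<lambda>x. \<Sum>i\<in>I. f i x) \<in> H_one"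
  by (induction I rule: infinite_finite_induct) (auto intro: H_one_zero H_one_add)

lemma H_one_diff: "f \<in> H_one \<Longrightarrow> g \<in> H_one \<Longrightarrow> (\<lambda>x. f x - g x) \<in> H_one"
  using H_one_add[OF _ H_one_scale[of g "-1"], of f] by simp

lemma H_one_continuous:
  assumes "f \<in> H_one"
  shows "continuous_on stiefel (f :: real^'m::finite^'n::finite \<Rightarrow> complex)"
proof -
  obtain S c where S: "finite S" "S \<subseteq> (SO_group :: (real^('n+'m)^('n+'m)) set)"
      "f = (\<lambda>\<eta>. \<Sum>h\<in>S. c h * tau h const_one \<eta>)"
    using assms unfolding H_one_def by blast
  have "continuous_on stiefel (tau h (const_one :: real^'m^'n \<Rightarrow> complex))" if "h \<in> S" for h
  proof -
    have "h \<in> SO_group"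
      using that S by blast
    then show ?thesis
      using continuous_on_J_pow[OF SO_group_inv]
      by (subst continuous_on_cong[OF refl tau_const_one]) (auto intro!: continuous_intros)
  qed
  then show ?thesis
    unfolding S(3) by (intro continuous_intros)
qed

lemma rot_H_one:
  assumes "A \<in> rotations TYPE('m)" "f \<in> H_one"
  shows "rot A f \<in> (H_one :: (real^'m::finite^'n::finite \<Rightarrow> complex) set)"
proof -
  obtain S c where S: "finite S" "S \<subseteq> (SO_group :: (real^('n+'m)^('n+'m)) set)"
      "f = (\<lambda>\<eta>. \<Sum>h\<in>S. c h * tau h const_one \<eta>)"
    using assms unfolding H_one_def by blast
  have "rot A f = (\<lambda>\<eta>. \<Sum>h\<in>S. c h * rot A (tau h const_one) \<eta>)"
    by (simp add: S(3) rot_def)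
  also have "\<dots> = (\<lambda>\<eta>. \<Sum>h\<in>S. c h * tau (embed A ** h) const_one \<eta>)"
    using S(2) assms(1) by (intro ext sum.cong refl) (auto simp: rot_tau_const_one)
  also have "\<dots> \<in> H_one"
    using S(2) assms(1) by (intro H_one_sum H_one_scale tau_in_H_one SO_group_mult embed_in_SO_group) auto
  finally show ?thesis .
qed

section \<open>Averages over rotations\<close>

lemma id_in_rotations: "mat 1 \<in> rotations TYPE('m::finite)"
  by (simp add: rotations_def orthogonal_matrix_id embed_id)

text \<open>The value type stays general: the oscillation is estimated for real functions, while the
  orbit span consists of complex ones.\<close>

definition avg :: "(real^'n^'n) set \<Rightarrow> (real^'m^'n \<Rightarrow> 'a::real_vector) \<Rightarrow> real^'m^'n \<Rightarrow> 'a" where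
  "avg S f y = (1 / real (card S)) *\<^sub>R (\<Sum>A\<in>S. f (transpose A ** y))"

lemma rotation_stiefel:
  "A \<in> rotations TYPE('m) \<Longrightarrow> y \<in> stiefel \<Longrightarrow> transpose A ** y \<in> stiefel"
  for y :: "real^'m::finite^'n::finite"
  by (simp add: orthogonal_mult_stiefel rotations_def)

lemma dist_rotation:
  fixes x y :: "real^'m::finite^'n::finite"
  assumes "A \<in> rotations TYPE('m)"
  shows "dist (A ** x) (A ** y) = dist x y"
proof -
  have "A ** (x - y) = A ** x - A ** y"
    by (simp add: vec_eq_iff matrix_matrix_mult_def right_diff_distrib sum_subtractf)
  then show ?thesis
    using norm_orthogonal_mult[of A "x - y"] assms by (simp add: dist_norm rotations_def)
qed

text \<open>One rotation is chosen for each ordered pair from a finite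
  \<open>\<delta>/2\<close>-net. If \<open>p\<close> is close to \<open>y\<close> and
  \<open>q\<close> to \<open>x\<close>, the isometry taking \<open>p\<close> to \<open>q\<close>
  takes \<open>y\<close> to within \<open>\<delta>\<close> of \<open>x\<close>.\<close>

lemma rotation_net:
  assumes "CARD('m) < CARD('n)" "\<delta> > 0"
  obtains S where "finite S" "S \<noteq> {}" "S \<subseteq> rotations TYPE('m)"
    "\<And>x y :: real^'m::finite^'n::finite. x \<in> stiefel \<Longrightarrow> y \<in> stiefel \<Longrightarrow>
      \<exists>A\<in>S. dist (transpose A ** y) x < \<delta>"
proof -
  obtain K where K: "finite K" "K \<subseteq> stiefel" "(stiefel :: (real^'m^'n) set) \<subseteq> (\<Union>x\<in>K. ball x (\<delta>/2))"
    using seq_compact_imp_totally_bounded[OF compact_stiefel[unfolded compact_eq_seq_compact_metric],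
        rule_format, of "\<delta>/2"] assms(2)
    by auto
  have "\<exists>A\<in>rotations TYPE('m). A ** p = q" if "p \<in> K" "q \<in> K" for p q
    using rotations_transitive assms(1) K(2) that by blast
  then obtain R where R: "\<And>p q. p \<in> K \<Longrightarrow> q \<in> K \<Longrightarrow> R p q \<in> rotations TYPE('m) \<and> R p q ** p = q"
    by metis
  \<comment> \<open>Transposes are collected because \<open>avg\<close> applies the transpose of its
    index. The identity makes the set nonempty whatever the net is.\<close>
  define S where "S = insert (mat 1) ((\<lambda>(p, q). transpose (R p q)) ` (K \<times> K))"
  have "\<exists>A\<in>S. dist (transpose A ** y) x < \<delta>" if xy: "x \<in> stiefel" "y \<in> stiefel"
    for x y :: "real^'m^'n"
  proof -
    obtain p where p: "p \<in> K" "dist p y < \<delta>/2"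
      using subsetD[OF K(3) xy(2)] by auto
    obtain q where q: "q \<in> K" "dist q x < \<delta>/2"
      using subsetD[OF K(3) xy(1)] by auto
    note pq = p(1) q(1) p(2) q(2)
    have "dist (R p q ** y) x \<le> dist (R p q ** y) q + dist q x"
      by (rule dist_triangle)
    also have "dist (R p q ** y) q = dist (R p q ** y) (R p q ** p)"
      using R[OF pq(1,2)] by simp
    also have "\<dots> + dist q x = dist y p + dist q x"
      using R[OF pq(1,2)] by (metis dist_rotation)
    also have "\<dots> < \<delta>"
      using pq(3,4) by (simp add: dist_commute)
    finally show ?thesis
      using pq(1,2) by (intro bexI[of _ "transpose (R p q)"]) (auto simp: S_def)
  qed
  moreover have "finite S" "S \<noteq> {}" "S \<subseteq> rotations TYPE('m)"
    using K(1) R by (auto simp: S_def id_in_rotations intro!: transpose_rotation)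
  ultimately show thesis
    using that by blast
qed

section \<open>Contraction of the oscillation under averaging\<close>

lemma avg_upper:
  fixes f :: "real^'m^'n \<Rightarrow> real"
  assumes "finite S" "S \<noteq> {}" "\<And>A. A \<in> S \<Longrightarrow> f (transpose A ** y) \<le> M"
  shows "avg S f y \<le> M"
  using sum_bounded_above[of S "\<lambda>A. f (transpose A ** y)" M] assms
  by (simp add: avg_def field_simps card_gt_0_iff)

lemma avg_lower:
  fixes f :: "real^'m^'n \<Rightarrow> real"
  assumes "finite S" "S \<noteq> {}" "\<And>A. A \<in> S \<Longrightarrow> M \<le> f (transpose A ** y)"
  shows "M \<le> avg S f y"
  using sum_bounded_below[of S M "\<lambda>A. f (transpose A ** y)"] assms
  by (simp add: avg_def field_simps card_gt_0_iff)

lemma norm_avg_le: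
  fixes f :: "real^'m^'n \<Rightarrow> 'a::real_normed_vector"
  assumes "finite S" "S \<noteq> {}" "\<And>A. A \<in> S \<Longrightarrow> norm (f (transpose A ** y)) \<le> M"
  shows "norm (avg S f y) \<le> M"
proof -
  have "norm (\<Sum>A\<in>S. f (transpose A ** y)) \<le> (\<Sum>A\<in>S. M)"
    using assms(3) by (intro order.trans[OF norm_sum] sum_mono)
  then show ?thesis
    using assms by (simp add: avg_def field_simps card_gt_0_iff)
qed

text \<open>Rotations are isometries of the Stiefel manifold, so averaging does not worsen the
  modulus of continuity. This lets one finite set of rotations serve for all iterations.\<close>

lemma avg_modulus:
  fixes f :: "real^'m::finite^'n::finite \<Rightarrow> real"
  assumes S: "finite S" "S \<noteq> {}" "S \<subseteq> rotations TYPE('m)"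
    and f: "\<And>x y. x \<in> stiefel \<Longrightarrow> y \<in> stiefel \<Longrightarrow> dist x y < \<delta> \<Longrightarrow> \<bar>f x - f y\<bar> \<le> \<epsilon>"
    and xy: "x \<in> stiefel" "y \<in> stiefel" "dist x y < \<delta>"
  shows "\<bar>avg S f x - avg S f y\<bar> \<le> \<epsilon>"
proof -
  have "\<bar>f (transpose A ** x) - f (transpose A ** y)\<bar> \<le> \<epsilon>" if "A \<in> S" for A
    using that S(3) xy by (intro f rotation_stiefel) (auto simp: dist_rotation transpose_rotation)
  then have "(\<Sum>A\<in>S. \<bar>f (transpose A ** x) - f (transpose A ** y)\<bar>) \<le> real (card S) * \<epsilon>"
    using sum_bounded_above by (metis (no_types, lifting))
  then have "\<bar>\<Sum>A\<in>S. f (transpose A ** x) - f (transpose A ** y)\<bar> \<le> real (card S) * \<epsilon>"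
    by (rule order.trans[OF sum_abs])
  moreover have "avg S f x - avg S f y = (\<Sum>A\<in>S. f (transpose A ** x) - f (transpose A ** y)) / real (card S)"
    by (simp add: avg_def sum_subtractf diff_divide_distrib)
  moreover have "real (card S) > 0"
    using S by (simp add: card_gt_0_iff)
  ultimately show ?thesis
    by (simp only: abs_divide) (simp add: pos_divide_le_eq mult.commute)
qed

text \<open>Either \<open>g\<close> is at most the midpoint of \<open>m\<close> and \<open>M\<close>
  at some \<open>x\<close>; then for each \<open>y\<close> one rotation of \<open>S\<close> brings
  \<open>y\<close> close to \<open>x\<close>, and that single term lowers the average. Or all values
  exceed the midpoint, which becomes the new lower bound. In the first case the excess over
  \<open>2 * \<epsilon>\<close> is multiplied by exactly \<open>1 - 1 / (2 * N)\<close>, in the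
  second it is at most that; hence the term \<open>2 * \<epsilon>\<close> in the conclusion.\<close>

lemma avg_oscillation_step:
  fixes g :: "real^'m::finite^'n::finite \<Rightarrow> real"
  assumes S: "finite S" "S \<noteq> {}" "S \<subseteq> rotations TYPE('m)"
    and net: "\<And>x y :: real^'m^'n. x \<in> stiefel \<Longrightarrow> y \<in> stiefel \<Longrightarrow> \<exists>A\<in>S. dist (transpose A ** y) x < \<delta>"
    and g: "\<And>x y. x \<in> stiefel \<Longrightarrow> y \<in> stiefel \<Longrightarrow> dist x y < \<delta> \<Longrightarrow> \<bar>g x - g y\<bar> \<le> \<epsilon>"
    and \<epsilon>: "\<epsilon> \<ge> 0" and y0: "y0 \<in> (stiefel :: (real^'m^'n) set)"
    and bd: "\<And>y. y \<in> stiefel \<Longrightarrow> m \<le> g y \<and> g y \<le> M"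
  shows "\<exists>m' M'. (\<forall>y\<in>stiefel. m' \<le> avg S g y \<and> avg S g y \<le> M') \<and>
    M' - m' - 2 * \<epsilon> \<le> (1 - 1 / (2 * real (card S))) * (M - m - 2 * \<epsilon>)"
proof -
  define N where "N = real (card S)"
  have N: "N \<ge> 1"
    using S by (simp add: N_def Suc_le_eq card_gt_0_iff)
  have mM: "m \<le> M"
    using bd[OF y0] by linarith
  have st: "transpose A ** y \<in> stiefel" if "A \<in> S" "y \<in> stiefel" for A and y :: "real^'m^'n"
    using that S(3) by (intro rotation_stiefel) auto
  show ?thesis
  proof (cases "\<exists>x\<in>stiefel. g x \<le> (m + M) / 2")
    case True
    then obtain x where x: "x \<in> stiefel" "g x \<le> (m + M) / 2"
      by blast
    have "avg S g y \<le> M - ((M - m) / 2 - \<epsilon>) / N" if y: "y \<in> stiefel" for y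
    proof -
      obtain A where A: "A \<in> S" "dist (transpose A ** y) x < \<delta>"
        using net[OF x(1) y] by blast
      have "(\<Sum>B\<in>S. g (transpose B ** y)) = g (transpose A ** y) + (\<Sum>B\<in>S - {A}. g (transpose B ** y))"
        using A S by (simp add: sum.remove)
      also have "g (transpose A ** y) \<le> (m + M) / 2 + \<epsilon>"
        using g[OF st[OF A(1) y] x(1) A(2)] x(2) by linarith
      also have "(\<Sum>B\<in>S - {A}. g (transpose B ** y)) \<le> real (card (S - {A})) * M"
        using bd st y by (intro sum_bounded_above) auto
      also have "real (card (S - {A})) = N - 1"
        using A(1) S N by (simp add: N_def card_Diff_singleton of_nat_diff)
      finally have "(\<Sum>B\<in>S. g (transpose B ** y)) \<le> N * M - ((M - m) / 2 - \<epsilon>)"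
        by (simp add: algebra_simps) (simp add: field_simps)
      then have "(\<Sum>B\<in>S. g (transpose B ** y)) / N \<le> (N * M - ((M - m) / 2 - \<epsilon>)) / N"
        using N by (intro divide_right_mono) auto
      then show ?thesis
        using N by (simp add: avg_def N_def[symmetric] diff_divide_distrib)
    qed
    moreover have "m \<le> avg S g y" if "y \<in> stiefel" for y
      using that S bd st by (intro avg_lower) auto
    moreover have "M - ((M - m) / 2 - \<epsilon>) / N - m - 2 * \<epsilon> = (1 - 1 / (2 * N)) * (M - m - 2 * \<epsilon>)"
      using N by (simp add: field_simps)
    ultimately show ?thesis
      unfolding N_def by (intro exI[of _ m] exI conjI ballI) auto
  next
    case False
    have "(m + M) / 2 \<le> avg S g y \<and> avg S g y \<le> M" if y: "y \<in> stiefel" for y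
    proof
      show "(m + M) / 2 \<le> avg S g y"
        using False st[OF _ y] S by (intro avg_lower) (auto simp: not_le intro: less_imp_le)
      show "avg S g y \<le> M"
        using st[OF _ y] S bd by (intro avg_upper) auto
    qed
    moreover have "M - (m + M) / 2 - 2 * \<epsilon> \<le> (1 - 1 / (2 * N)) * (M - m - 2 * \<epsilon>)"
    proof -
      have "(M - m) / N \<le> M - m"
        using N mM by (simp add: divide_le_eq mult_le_cancel_left1)
      moreover have "\<epsilon> / N \<ge> 0"
        using N \<epsilon> by simp
      moreover have "(1 - 1 / (2 * N)) * (M - m - 2 * \<epsilon>) = (M - m) - (M - m) / N / 2 - 2 * \<epsilon> + \<epsilon> / N"
        using N by (simp add: field_simps)
      ultimately show ?thesis by argo
    qed
    ultimately show ?thesis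
      unfolding N_def by blast
  qed
qed

text \<open>The step is iterated from the interval between \<open>-B\<close> and \<open>B\<close>.
  Its excess over \<open>2 * \<epsilon>\<close> decays geometrically, while
  \<open>2 * \<epsilon>\<close> itself is the part that the net cannot resolve.\<close>

lemma avg_oscillation:
  fixes g :: "real^'m::finite^'n::finite \<Rightarrow> real"
  assumes S: "finite S" "S \<noteq> {}" "S \<subseteq> rotations TYPE('m)"
    and net: "\<And>x y :: real^'m^'n. x \<in> stiefel \<Longrightarrow> y \<in> stiefel \<Longrightarrow> \<exists>A\<in>S. dist (transpose A ** y) x < \<delta>"
    and g: "\<And>x y. x \<in> stiefel \<Longrightarrow> y \<in> stiefel \<Longrightarrow> dist x y < \<delta> \<Longrightarrow> \<bar>g x - g y\<bar> \<le> \<epsilon>"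
    and \<epsilon>: "\<epsilon> \<ge> 0"
    and bd: "\<And>y. y \<in> stiefel \<Longrightarrow> \<bar>g y\<bar> \<le> B"
    and xy: "x \<in> stiefel" "y \<in> stiefel"
  shows "\<bar>(avg S ^^ k) g x - (avg S ^^ k) g y\<bar> \<le> 2 * \<epsilon> + (1 - 1 / (2 * real (card S))) ^ k * (2 * B)"
proof -
  define q where "q = 1 - 1 / (2 * real (card S))"
  have "real (card S) \<ge> 1"
    using S by (simp add: Suc_le_eq card_gt_0_iff)
  then have q: "q \<ge> 0" "q \<le> 1"
    by (auto simp: q_def field_simps)
  \<comment> \<open>The pair \<open>\<delta>\<close>, \<open>\<epsilon>\<close> is inherited by
    every iterate, so the one-step estimate applies to each of them with the same contraction
    factor.\<close>
  have mod: "\<bar>(avg S ^^ k) g x - (avg S ^^ k) g y\<bar> \<le> \<epsilon>"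
    if "x \<in> stiefel" "y \<in> stiefel" "dist x y < \<delta>" for k x y
    using that
  proof (induction k arbitrary: x y)
    case (Suc k)
    then show ?case
      using avg_modulus[OF S, of \<delta> "(avg S ^^ k) g" \<epsilon> x y] by simp
  qed (use g in simp)
  have "\<exists>m M. (\<forall>y\<in>stiefel. m \<le> (avg S ^^ k) g y \<and> (avg S ^^ k) g y \<le> M) \<and>
    M - m - 2 * \<epsilon> \<le> q ^ k * (2 * B - 2 * \<epsilon>)"
  proof (induction k)
    case 0
    show ?case
      using bd by (intro exI[of _ "-B"] exI[of _ B]) (auto simp: abs_le_iff minus_le_iff)
  next
    case (Suc k)
    then obtain m M where mM: "\<And>y. y \<in> stiefel \<Longrightarrow> m \<le> (avg S ^^ k) g y \<and> (avg S ^^ k) g y \<le> M"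
      "M - m - 2 * \<epsilon> \<le> q ^ k * (2 * B - 2 * \<epsilon>)"
      by blast
    obtain m' M' where "\<forall>y\<in>stiefel. m' \<le> avg S ((avg S ^^ k) g) y \<and> avg S ((avg S ^^ k) g) y \<le> M'"
      "M' - m' - 2 * \<epsilon> \<le> q * (M - m - 2 * \<epsilon>)"
      using avg_oscillation_step[where g = "(avg S ^^ k) g", OF S net mod \<epsilon> xy(1) mM(1)]
      unfolding q_def by blast
    moreover have "q * (M - m - 2 * \<epsilon>) \<le> q * (q ^ k * (2 * B - 2 * \<epsilon>))"
      using mM(2) q(1) by (rule mult_left_mono)
    ultimately show ?case
      by (intro exI[of _ m'] exI[of _ M']) auto
  qed
  then obtain m M where "\<And>y. y \<in> stiefel \<Longrightarrow> m \<le> (avg S ^^ k) g y \<and> (avg S ^^ k) g y \<le> M"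
    "M - m - 2 * \<epsilon> \<le> q ^ k * (2 * B - 2 * \<epsilon>)"
    by blast
  from this(1)[OF xy(1)] this(1)[OF xy(2)] this(2)
  have "\<bar>(avg S ^^ k) g x - (avg S ^^ k) g y\<bar> \<le> 2 * \<epsilon> + q ^ k * (2 * B - 2 * \<epsilon>)"
    by linarith
  also have "\<dots> \<le> 2 * \<epsilon> + q ^ k * (2 * B)"
    using q \<epsilon> by (intro add_left_mono mult_left_mono) auto
  finally show ?thesis
    by (simp add: q_def)
qed

lemma Re_avg_iter: "Re ((avg S ^^ k) f y) = (avg S ^^ k) (\<lambda>x. Re (f x)) y"
proof (induction k arbitrary: y)
  case (Suc k)
  then show ?case by (simp add: avg_def)
qed simp

lemma Im_avg_iter: "Im ((avg S ^^ k) f y) = (avg S ^^ k) (\<lambda>x. Im (f x)) y"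
proof (induction k arbitrary: y)
  case (Suc k)
  then show ?case by (simp add: avg_def)
qed simp

text \<open>The net is built from a modulus of continuity of \<open>f\<close> itself, so real and
  imaginary parts are flattened by the same \<open>S\<close> and the same \<open>k\<close>.\<close>

lemma avg_near_constant:
  fixes f :: "real^'m::finite^'n::finite \<Rightarrow> complex"
  assumes card: "CARD('m) < CARD('n)" and f: "continuous_on stiefel f" and e: "e > 0"
  obtains S k where "finite S" "S \<noteq> {}" "S \<subseteq> rotations TYPE('m)"
    "\<And>x y. x \<in> stiefel \<Longrightarrow> y \<in> stiefel \<Longrightarrow> cmod ((avg S ^^ k) f x - (avg S ^^ k) f y) \<le> e"
proof -
  \<comment> \<open>The real and the imaginary part may each oscillate by \<open>e / 2\<close>,
    which is twice \<open>e / 6\<close> from the modulus and once \<open>e / 6\<close> from the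
    geometric term.\<close>
  obtain \<delta> where \<delta>: "\<delta> > 0"
    "\<And>x y. x \<in> stiefel \<Longrightarrow> y \<in> stiefel \<Longrightarrow> dist y x < \<delta> \<Longrightarrow> dist (f y) (f x) < e / 6"
    using compact_uniformly_continuous[OF f compact_stiefel] e
    unfolding uniformly_continuous_on_def by (metis divide_pos_pos zero_less_numeral)
  have "compact (f ` stiefel)"
    using compact_continuous_image[OF f compact_stiefel] .
  then obtain B where B: "B > 0" "\<And>y. y \<in> stiefel \<Longrightarrow> cmod (f y) \<le> B"
    using compact_imp_bounded bounded_pos by (metis imageI)
  obtain S where S: "finite S" "S \<noteq> {}" "S \<subseteq> rotations TYPE('m)"
    and net: "\<And>x y :: real^'m^'n. x \<in> stiefel \<Longrightarrow> y \<in> stiefel \<Longrightarrow> \<exists>A\<in>S. dist (transpose A ** y) x < \<delta>"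
    using rotation_net[OF card \<delta>(1)] by blast
  define q where "q = 1 - 1 / (2 * real (card S))"
  have "real (card S) \<ge> 1"
    using S by (simp add: Suc_le_eq card_gt_0_iff)
  then have q: "0 \<le> q" "q < 1"
    by (auto simp: q_def field_simps)
  obtain k where "q ^ k < e / 6 / (2 * B)"
    using real_arch_pow_inv[OF _ q(2), of "e / 6 / (2 * B)"] e B(1) by auto
  then have k: "q ^ k * (2 * B) \<le> e / 6"
    using B(1) by (simp add: field_simps)
  have "cmod ((avg S ^^ k) f x - (avg S ^^ k) f y) \<le> e" if xy: "x \<in> stiefel" "y \<in> stiefel" for x y
  proof -
    have "\<bar>(avg S ^^ k) (\<lambda>x. Re (f x)) x - (avg S ^^ k) (\<lambda>x. Re (f x)) y\<bar> \<le> 2 * (e / 6) + q ^ k * (2 * B)"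
      unfolding q_def
    proof (rule avg_oscillation[OF S net])
      show "\<bar>Re (f x) - Re (f y)\<bar> \<le> e / 6" if "x \<in> stiefel" "y \<in> stiefel" "dist x y < \<delta>" for x y
        using \<delta>(2)[OF that(2,1,3)] abs_Re_le_cmod[of "f x - f y"] by (simp add: dist_norm)
      show "\<bar>Re (f y)\<bar> \<le> B" if "y \<in> stiefel" for y
        using B(2)[OF that] abs_Re_le_cmod order.trans by blast
    qed (use e xy in auto)
    moreover have "\<bar>(avg S ^^ k) (\<lambda>x. Im (f x)) x - (avg S ^^ k) (\<lambda>x. Im (f x)) y\<bar> \<le> 2 * (e / 6) + q ^ k * (2 * B)"
      unfolding q_def
    proof (rule avg_oscillation[OF S net])
      show "\<bar>Im (f x) - Im (f y)\<bar> \<le> e / 6" if "x \<in> stiefel" "y \<in> stiefel" "dist x y < \<delta>" for x y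
        using \<delta>(2)[OF that(2,1,3)] abs_Im_le_cmod[of "f x - f y"] by (simp add: dist_norm)
      show "\<bar>Im (f y)\<bar> \<le> B" if "y \<in> stiefel" for y
        using B(2)[OF that] abs_Im_le_cmod order.trans by blast
    qed (use e xy in auto)
    ultimately have "\<bar>Re ((avg S ^^ k) f x - (avg S ^^ k) f y)\<bar> + \<bar>Im ((avg S ^^ k) f x - (avg S ^^ k) f y)\<bar> \<le> e"
      using k by (simp add: Re_avg_iter Im_avg_iter)
    then show ?thesis
      using cmod_le order.trans by blast
  qed
  with S show thesis
    using that by blast
qed

section \<open>The kernel on the diagonal\<close>

text \<open>A kernel vector satisfies \<open>x = r *\<^sub>R (u *v y)\<close> with
  \<open>y = transpose v *v x\<close>. As \<open>u\<close> is isometric, \<open>x\<close> has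
  \<open>r\<close> times the norm of \<open>y\<close>; as the adjoint of the isometry
  \<open>v\<close> is a contraction, \<open>y\<close> is no longer than \<open>x\<close>. Both
  cannot hold for \<open>r < 1\<close> and \<open>x\<close> nonzero.\<close>

lemma kernel_det_nonzero:
  fixes u v :: "real^'m::finite^'n::finite"
  assumes u: "u \<in> stiefel" and v: "v \<in> stiefel" and r: "0 \<le> r" "r < 1"
  shows "det (mat 1 - r *\<^sub>R (u ** transpose v)) \<noteq> 0"
proof
  assume "det (mat 1 - r *\<^sub>R (u ** transpose v)) = 0"
  then obtain x where x: "x \<noteq> 0" "(mat 1 - r *\<^sub>R (u ** transpose v)) *v x = 0"
    by (metis invertible_det_nz invertible_left_inverse matrix_left_invertible_ker)
  define y where "y = transpose v *v x"
  have iso: "norm (w *v z) = norm z" if "w \<in> stiefel" for w :: "real^'m^'n" and z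
    using that by (simp add: stiefel_inner norm_eq)
  have "x = r *\<^sub>R (u *v y)"
    using x(2) unfolding y_def matrix_vector_mul_assoc
    by (simp add: matrix_vector_mult_diff_rdistrib scaleR_matrix_vector_assoc[symmetric])
  then have nx: "norm x = r * norm y"
    using r(1) iso[OF u] by (metis abs_of_nonneg norm_scaleR)
  have "(norm y)\<^sup>2 = (v *v y) \<bullet> x"
    unfolding y_def power2_norm_eq_inner by (metis dot_lmul_matrix inner_commute transpose_matrix_vector)
  also have "\<dots> \<le> norm y * norm x"
    using norm_cauchy_schwarz[of "v *v y" x] iso[OF v] by simp
  finally have "norm y \<le> norm x"
    by (cases "y = 0") (simp_all add: power2_eq_square)
  moreover have "norm y > 0"
    using nx x(1) r(1) by fastforce
  moreover have "r * norm y < norm y"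
    using r(2) \<open>norm y > 0\<close> by simp
  ultimately show False
    using nx by linarith
qed

lemma continuous_on_kernel_det:
  fixes f :: "'a::topological_space \<Rightarrow> real" and u v :: "'a \<Rightarrow> real^'m::finite^'n::finite"
  assumes "continuous_on S f" "continuous_on S u" "continuous_on S v"
  shows "continuous_on S (\<lambda>x. det (mat 1 - f x *\<^sub>R (u x ** transpose (v x))))"
  by (intro continuous_on_det continuous_intros continuous_on_matrix_mult continuous_on_transpose assms)

text \<open>The determinant is 1 at \<open>r = 0\<close> and has no zero before 1, so it keeps its
  sign by the intermediate value theorem.\<close>

lemma kernel_det_pos:
  fixes u v :: "real^'m::finite^'n::finite"
  assumes u: "u \<in> stiefel" and v: "v \<in> stiefel" and r: "0 \<le> r" "r < 1"
  shows "det (mat 1 - r *\<^sub>R (u ** transpose v)) > 0"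
proof (rule ccontr)
  let ?k = "\<lambda>s. det (mat 1 - s *\<^sub>R (u ** transpose v))"
  assume "\<not> ?k r > 0"
  then have "?k r \<le> 0" "0 \<le> ?k 0"
    by auto
  then obtain s where "0 \<le> s" "s \<le> r" "?k s = 0"
    using IVT2'[of ?k r 0 0, OF _ _ r(1) continuous_on_kernel_det] by (auto intro: continuous_intros)
  then show False
    using kernel_det_nonzero[OF u v, of s] r(2) by linarith
qed

text \<open>Unlike its inverse, the determinant is continuous up to and including
  \<open>r = 1\<close>, so compactness applies. The outcome is a lower bound \<open>1 / C\<close> of
  the kernel that is uniform in \<open>r\<close>.\<close>

lemma kernel_det_bounded:
  obtains C where "C > 0"
    "\<And>r u v. 0 \<le> r \<Longrightarrow> r < 1 \<Longrightarrow> u \<in> stiefel \<Longrightarrow> v \<in> (stiefel :: (real^'m::finite^'n::finite) set) \<Longrightarrow>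
      det (mat 1 - r *\<^sub>R (u ** transpose v)) \<le> C"
proof -
  let ?k = "\<lambda>(r, u, v). det (mat 1 - r *\<^sub>R (u ** transpose (v :: real^'m^'n)))"
  have "compact (?k ` ({0..1} \<times> stiefel \<times> stiefel))"
    by (intro compact_continuous_image compact_Times compact_stiefel compact_Icc)
       (auto simp: case_prod_unfold intro!: continuous_on_kernel_det continuous_intros)
  then obtain C where C: "C > 0" "\<And>z. z \<in> ?k ` ({0..1} \<times> stiefel \<times> stiefel) \<Longrightarrow> norm z \<le> C"
    using compact_imp_bounded bounded_pos by metis
  show thesis
  proof (rule that[OF C(1)])
    fix r :: real and u v :: "real^'m^'n"
    assume "0 \<le> r" "r < 1" "u \<in> stiefel" "v \<in> stiefel"
    then have "?k (r, u, v) \<in> ?k ` ({0..1} \<times> stiefel \<times> stiefel)"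
      by (intro imageI) auto
    from C(2)[OF this] show "det (mat 1 - r *\<^sub>R (u ** transpose v)) \<le> C"
      by simp
  qed
qed

section \<open>Functions on the Stiefel manifold\<close>

locale stiefel_prob =
  fixes \<omega> :: "(real^'m::finite^'n::finite) measure"
  assumes sets_omega: "sets \<omega> = sets (restrict_space borel stiefel)"
    and emeasure_omega: "emeasure \<omega> (space \<omega>) = 1"
begin

lemma space_omega: "space \<omega> = stiefel"
  using sets_eq_imp_space_eq[OF sets_omega] by (simp add: space_restrict_space)

sublocale prob_space \<omega>
  by (rule prob_spaceI) (rule emeasure_omega)

lemma continuous_measurable:
  fixes f :: "real^'m^'n \<Rightarrow> 'a::topological_space"
  shows "continuous_on stiefel f \<Longrightarrow> f \<in> borel_measurable \<omega>"
  using borel_measurable_continuous_on_restrict[of stiefel f] measurable_cong_sets[OF sets_omega refl] by blast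

lemma continuous_bounded:
  fixes f :: "real^'m^'n \<Rightarrow> 'a::real_normed_vector"
  assumes "continuous_on stiefel f"
  obtains B where "B > 0" "\<And>y. y \<in> stiefel \<Longrightarrow> norm (f y) \<le> B"
  using compact_imp_bounded[OF compact_continuous_image[OF assms compact_stiefel]] bounded_pos
  by (metis imageI)

lemma continuous_integrable:
  fixes f :: "real^'m^'n \<Rightarrow> 'a::{banach, second_countable_topology}"
  assumes "continuous_on stiefel f"
  shows "integrable \<omega> f"
proof -
  obtain B where "\<And>y. y \<in> stiefel \<Longrightarrow> norm (f y) \<le> B"
    using continuous_bounded[OF assms] by blast
  then show ?thesis
    by (intro integrable_const_bound[of _ B] continuous_measurable[OF assms]) (auto simp: space_omega)
qed

lemma F_fun_const_one:
  "F_fun \<omega> const_one r u =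
    complex_of_real (LINT v|\<omega>. inverse (det (mat 1 - r *\<^sub>R (u ** transpose v))))"
proof -
  have "F_fun \<omega> const_one r u =
      (LINT v|\<omega>. complex_of_real (inverse (det (mat 1 - r *\<^sub>R (u ** transpose v)))))"
    unfolding F_fun_def by (intro Bochner_Integration.integral_cong) (auto simp: space_omega const_one_def)
  then show ?thesis
    by (simp only: integral_complex_of_real)
qed

text \<open>For fixed \<open>r < 1\<close> the kernel is uniformly continuous on a compact product.
  The continuity passes to the uniform limit and secures its integrability.\<close>

lemma continuous_on_F_fun_const_one:
  assumes r: "0 \<le> r" "r < 1"
  shows "continuous_on stiefel (F_fun \<omega> const_one r)"
proof -
  let ?k = "\<lambda>(u, v). inverse (det (mat 1 - r *\<^sub>R (u ** transpose (v :: real^'m^'n))))"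
  have cont: "continuous_on (stiefel \<times> stiefel) ?k"
    unfolding case_prod_unfold
    using kernel_det_nonzero[OF _ _ r]
    by (intro continuous_on_inverse continuous_on_kernel_det continuous_intros) auto
  have int: "integrable \<omega> (\<lambda>v. ?k (u, v))" if "u \<in> stiefel" for u
    using that by (intro continuous_integrable continuous_on_compose2[OF cont] continuous_intros) auto
  have "continuous_on stiefel (\<lambda>u. LINT v|\<omega>. ?k (u, v))"
    unfolding continuous_on_iff
  proof (intro ballI allI impI)
    fix u :: "real^'m^'n" and e :: real
    assume u: "u \<in> stiefel" and e: "e > 0"
    have "uniformly_continuous_on (stiefel \<times> stiefel) ?k"
      by (intro compact_uniformly_continuous cont compact_Times compact_stiefel)
    then obtain d where d: "d > 0" "\<And>p q. p \<in> stiefel \<times> stiefel \<Longrightarrow> q \<in> stiefel \<times> stiefel \<Longrightarrow>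
        dist q p < d \<Longrightarrow> dist (?k q) (?k p) < e / 2"
      unfolding uniformly_continuous_on_def by (meson e half_gt_zero)
    have "dist (LINT v|\<omega>. ?k (u', v)) (LINT v|\<omega>. ?k (u, v)) < e"
      if u': "u' \<in> stiefel" "dist u' u < d" for u'
    proof -
      have "norm (LINT v|\<omega>. ?k (u', v) - ?k (u, v)) \<le> (LINT v|\<omega>. norm (?k (u', v) - ?k (u, v)))"
        by (rule integral_norm_bound)
      also have "\<dots> \<le> e / 2"
      proof (rule integral_le_const)
        show "integrable \<omega> (\<lambda>v. norm (?k (u', v) - ?k (u, v)))"
          using int u u' by (intro integrable_norm Bochner_Integration.integrable_diff) auto
        show "AE v in \<omega>. norm (?k (u', v) - ?k (u, v)) \<le> e / 2"
        proof (rule AE_I2)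
          fix v assume "v \<in> space \<omega>"
          then have "dist (?k (u', v)) (?k (u, v)) < e / 2"
            using u u' by (intro d(2)) (auto simp: space_omega dist_Pair_Pair)
          then show "norm (?k (u', v) - ?k (u, v)) \<le> e / 2"
            by (simp add: dist_norm)
        qed
      qed
      finally show ?thesis
        using e int[OF u] int[OF u'(1)] by (simp add: dist_norm Bochner_Integration.integral_diff)
    qed
    with d(1) show "\<exists>d>0. \<forall>u'\<in>stiefel. dist u' u < d \<longrightarrow>
        dist (LINT v|\<omega>. ?k (u', v)) (LINT v|\<omega>. ?k (u, v)) < e"
      by blast
  qed
  then have "continuous_on stiefel (\<lambda>u. complex_of_real (LINT v|\<omega>. ?k (u, v)))"
    by (intro continuous_intros)
  then show ?thesis
    by (simp add: F_fun_const_one[abs_def])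
qed

text \<open>The kernel is at least \<open>1 / C\<close> for all \<open>0 \<le> r < 1\<close>;
  integration against a probability measure, the limit in \<open>r\<close> and a second integration
  preserve this bound on the real part.\<close>

lemma C0_form_const_one_nonzero:
  assumes "const_one \<in> C0 \<omega>"
  shows "C0_form \<omega> const_one const_one \<noteq> 0"
proof -
  let ?k = "\<lambda>r u v. det (mat 1 - r *\<^sub>R (u ** transpose (v :: real^'m^'n)))"
  obtain F where F: "uniform_limit stiefel (F_fun \<omega> const_one) F (at_left 1)"
    using assms unfolding C0_def by blast
  obtain C where C: "C > 0"
    "\<And>r u v. 0 \<le> r \<Longrightarrow> r < 1 \<Longrightarrow> u \<in> stiefel \<Longrightarrow> v \<in> (stiefel :: (real^'m^'n) set) \<Longrightarrow> ?k r u v \<le> C"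
    using kernel_det_bounded by blast
  have ev: "eventually (\<lambda>r::real. 0 \<le> r \<and> r < 1) (at_left 1)"
    using eventually_at_left_real[of 0 "1::real"] by (auto elim!: eventually_mono)
  have "continuous_on stiefel F"
    using ev by (intro uniform_limit_theorem[OF _ F])
      (auto elim!: eventually_mono intro: continuous_on_F_fun_const_one)
  have lim: "((\<lambda>r. F_fun \<omega> const_one r u) \<longlongrightarrow> F u) (at_left 1)" if "u \<in> stiefel" for u
    using tendsto_uniform_limitI[OF F that] .
  have "F_lim \<omega> const_one u = F u" if "u \<in> stiefel" for u
    unfolding F_lim_def using lim[OF that] by (intro tendsto_Lim) auto
  then have form: "C0_form \<omega> const_one const_one = (LINT u|\<omega>. cnj (F u))"
    unfolding C0_form_def
    by (intro Bochner_Integration.integral_cong) (auto simp: space_omega const_one_def)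
  \<comment> \<open>Without integrability the form would be the default value 0 and the lower bound
    would say nothing about it.\<close>
  have int: "integrable \<omega> (\<lambda>u. cnj (F u))"
    by (intro continuous_integrable continuous_intros \<open>continuous_on stiefel F\<close>)
  have lb: "1 / C \<le> Re (F u)" if u: "u \<in> stiefel" for u
  proof (rule tendsto_lowerbound[OF tendsto_Re[OF lim[OF u]]])
    have "1 / C \<le> Re (F_fun \<omega> const_one r u)" if r: "0 \<le> r" "r < 1" for r
    proof -
      have "integrable \<omega> (\<lambda>v. inverse (?k r u v))"
        using kernel_det_nonzero[OF u _ r]
        by (intro continuous_integrable continuous_on_inverse continuous_on_kernel_det continuous_intros) auto
      moreover have "1 / C \<le> inverse (?k r u v)" if "v \<in> stiefel" for v
        using C(2)[OF r u that] kernel_det_pos[OF u that r] C(1)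
        by (simp add: divide_inverse le_imp_inverse_le)
      ultimately show ?thesis
        by (auto simp: F_fun_const_one space_omega intro!: integral_ge_const)
    qed
    then show "eventually (\<lambda>r. 1 / C \<le> Re (F_fun \<omega> const_one r u)) (at_left 1)"
      by (intro eventually_mono[OF ev]) auto
  qed auto
  have "1 / C \<le> (LINT u|\<omega>. Re (cnj (F u)))"
    using lb by (intro integral_ge_const integrable_Re int AE_I2) (auto simp: space_omega)
  then have "Re (C0_form \<omega> const_one const_one) \<ge> 1 / C"
    using integral_Re[OF int] by (simp add: form)
  then show ?thesis
    using C(1) by (auto simp: not_le[symmetric])
qed

text \<open>\<open>F_lim\<close> and Bochner integrals take junk values where nothing converges. Either \<open>F_lim \<omega> g\<close> is
  integrable, or, the functions \<open>tau h const_one\<close> being bounded away from zero, every pairing of one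
  of them with \<open>g\<close> is the junk value zero.\<close>

lemma F_lim_integrable_or_form_zero:
  assumes h: "h \<in> (SO_group :: (real^('n+'m)^('n+'m)) set)"
  shows "integrable \<omega> (F_lim \<omega> g) \<or> C0_form \<omega> (tau h const_one) g = 0"
proof (rule disjCI)
  assume "C0_form \<omega> (tau h const_one) g \<noteq> 0"
  then have int: "integrable \<omega> (\<lambda>u. tau h const_one u * cnj (F_lim \<omega> g u))"
    unfolding C0_form_def using not_integrable_integral_eq by blast
  define p where "p = J_pow (matrix_inv h) ((real CARD('n) - 2) / (real CARD('n) + real CARD('m)))"
  have p: "p u > 0" if "u \<in> stiefel" for u
    unfolding p_def using that h by (intro J_pow_pos SO_group_inv)
  have "continuous_on stiefel p"
    unfolding p_def using h by (intro continuous_on_J_pow SO_group_inv)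
  then have cp: "continuous_on stiefel (\<lambda>u. complex_of_real (inverse (p u)))"
    using p by (intro continuous_intros) force+
  obtain B where B: "\<And>u. u \<in> stiefel \<Longrightarrow> cmod (complex_of_real (inverse (p u))) \<le> B"
    using continuous_bounded[OF cp] by blast
  have "integrable \<omega> (\<lambda>u. complex_of_real (inverse (p u)) * (tau h const_one u * cnj (F_lim \<omega> g u)))"
  proof (rule Bochner_Integration.integrable_bound[of _ "\<lambda>u. B *\<^sub>R (tau h const_one u * cnj (F_lim \<omega> g u))"])
    show "integrable \<omega> (\<lambda>u. B *\<^sub>R (tau h const_one u * cnj (F_lim \<omega> g u)))"
      using int by simp
    show "(\<lambda>u. complex_of_real (inverse (p u)) * (tau h const_one u * cnj (F_lim \<omega> g u))) \<in> borel_measurable \<omega>"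
      using continuous_measurable[OF cp] borel_measurable_integrable[OF int] by (rule borel_measurable_times)
    show "AE u in \<omega>. norm (complex_of_real (inverse (p u)) * (tau h const_one u * cnj (F_lim \<omega> g u)))
        \<le> norm (B *\<^sub>R (tau h const_one u * cnj (F_lim \<omega> g u)))"
    proof (rule AE_I2)
      fix u assume "u \<in> space \<omega>"
      then have "cmod (complex_of_real (inverse (p u))) \<le> \<bar>B\<bar>"
        using B[of u] by (simp add: space_omega)
      then show "norm (complex_of_real (inverse (p u)) * (tau h const_one u * cnj (F_lim \<omega> g u)))
          \<le> norm (B *\<^sub>R (tau h const_one u * cnj (F_lim \<omega> g u)))"
        unfolding norm_mult norm_scaleR by (intro mult_right_mono) auto
    qed
  qed
  then have "integrable \<omega> (\<lambda>u. cnj (complex_of_real (inverse (p u)) * (tau h const_one u * cnj (F_lim \<omega> g u))))"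
    by (rule integrable_cnj)
  moreover have "cnj (complex_of_real (inverse (p u)) * (tau h const_one u * cnj (F_lim \<omega> g u))) = F_lim \<omega> g u"
    if "u \<in> space \<omega>" for u
    using that p[of u] by (simp add: space_omega tau_const_one[OF h] p_def)
  ultimately show "integrable \<omega> (F_lim \<omega> g)"
    by (rule Bochner_Integration.integrable_cong[THEN iffD1, OF refl, rotated])
qed

text \<open>This makes pairing with a fixed \<open>g\<close> continuous for the sup norm, the link
  from uniform estimates to the Hilbert space.\<close>

lemma C0_form_bound:
  assumes "integrable \<omega> (F_lim \<omega> g)" "\<epsilon> \<ge> 0" "\<And>u. u \<in> stiefel \<Longrightarrow> cmod (f u) \<le> \<epsilon>"
  shows "cmod (C0_form \<omega> f g) \<le> \<epsilon> * (LINT u|\<omega>. cmod (F_lim \<omega> g u))"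
proof -
  have "cmod (C0_form \<omega> f g) \<le> (LINT u|\<omega>. cmod (f u * cnj (F_lim \<omega> g u)))"
    unfolding C0_form_def by (rule integral_norm_bound)
  also have "\<dots> \<le> (LINT u|\<omega>. \<epsilon> * cmod (F_lim \<omega> g u))"
    using assms by (intro integral_mono') (auto simp: norm_mult space_omega intro!: mult_right_mono)
  finally show ?thesis by simp
qed

end

section \<open>The completed representation\<close>

locale tau_completion = stiefel_prob \<omega>
  for \<omega> :: "(real^'m::finite^'n::finite) measure" +
  fixes \<iota> :: "(real^'m^'n \<Rightarrow> complex) \<Rightarrow> 'k::complex_hilbert_space"
    and \<pi> :: "real^('n+'m)^('n+'m) \<Rightarrow> 'k \<Rightarrow> 'k"
  assumes card_less: "CARD('m) < CARD('n)"
    and completion: "hilbert_completion H_one (null_space \<omega> \<inter> H_one) (C0_form \<omega>) \<iota>"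
    and unitary: "unitary_representation SO_group \<pi>"
    and extends_tau: "\<And>h f. h \<in> SO_group \<Longrightarrow> f \<in> H_one \<Longrightarrow> \<pi> h (\<iota> f) = \<iota> (tau h f)"
begin

abbreviation e :: 'k where "e \<equiv> \<iota> const_one"

lemma iota_add: "f \<in> H_one \<Longrightarrow> g \<in> H_one \<Longrightarrow> \<iota> (\<lambda>x. f x + g x) = \<iota> f + \<iota> g"
  and iota_scale: "f \<in> H_one \<Longrightarrow> \<iota> (\<lambda>x. c * f x) = c *\<^sub>C \<iota> f"
  and iota_eq: "f \<in> H_one \<Longrightarrow> g \<in> H_one \<Longrightarrow> \<iota> f = \<iota> g \<longleftrightarrow> (\<lambda>x. f x - g x) \<in> null_space \<omega> \<inter> H_one"
  and cinner_iota: "f \<in> H_one \<Longrightarrow> g \<in> H_one \<Longrightarrow> cinner (\<iota> f) (\<iota> g) = C0_form \<omega> f g"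
  and iota_dense: "closure (\<iota> ` H_one) = UNIV"
  using completion unfolding hilbert_completion_def by auto

lemma iota_zero: "\<iota> (\<lambda>_. 0) = 0"
  using iota_scale[OF const_one_in_H_one, of 0] by (simp add: scaleC_zero_left)

lemma iota_diff: "f \<in> H_one \<Longrightarrow> g \<in> H_one \<Longrightarrow> \<iota> (\<lambda>x. f x - g x) = \<iota> f - \<iota> g"
  using iota_add[OF _ H_one_scale[of g "-1"], of f] iota_scale[of g "-1"] by (simp add: scaleC_minus1)

lemma iota_sum:
  "(\<And>i. i \<in> I \<Longrightarrow> f i \<in> H_one) \<Longrightarrow> \<iota> (\<lambda>x. \<Sum>i\<in>I. c i * f i x) = (\<Sum>i\<in>I. c i *\<^sub>C \<iota> (f i))"
proof (induction I rule: infinite_finite_induct)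
  case (insert i I)
  then have "\<iota> (\<lambda>x. c i * f i x + (\<Sum>i\<in>I. c i * f i x)) = \<iota> (\<lambda>x. c i * f i x) + \<iota> (\<lambda>x. \<Sum>i\<in>I. c i * f i x)"
    by (intro iota_add H_one_scale H_one_sum) auto
  with insert show ?case by (simp add: iota_scale)
qed (auto simp: iota_zero)

section \<open>Consequences of unitarity and the translates of the cyclic vector\<close>

lemma pi_add: "h \<in> SO_group \<Longrightarrow> \<pi> h (x + y) = \<pi> h x + \<pi> h y"
  and pi_scale: "h \<in> SO_group \<Longrightarrow> \<pi> h (c *\<^sub>C x) = c *\<^sub>C \<pi> h x"
  and cinner_pi: "h \<in> SO_group \<Longrightarrow> cinner (\<pi> h x) (\<pi> h y) = cinner x y"
  and pi_id: "\<pi> (mat 1) x = x"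
  and pi_mult: "g \<in> SO_group \<Longrightarrow> h \<in> SO_group \<Longrightarrow> \<pi> (g ** h) x = \<pi> g (\<pi> h x)"
  using unitary unfolding unitary_representation_def unitary_operator_def by auto

lemma pi_zero: "h \<in> SO_group \<Longrightarrow> \<pi> h 0 = 0"
  using pi_add[of h 0 0] by simp

lemma pi_diff: "h \<in> SO_group \<Longrightarrow> \<pi> h (x - y) = \<pi> h x - \<pi> h y"
  using pi_add[of h "x - y" y] by (simp add: algebra_simps)

lemma pi_sum: "h \<in> SO_group \<Longrightarrow> \<pi> h (\<Sum>i\<in>I. x i) = (\<Sum>i\<in>I. \<pi> h (x i))"
  by (induction I rule: infinite_finite_induct) (auto simp: pi_zero pi_add)

lemma norm_pi: "h \<in> SO_group \<Longrightarrow> norm (\<pi> h x) = norm x"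
proof -
  assume "h \<in> SO_group"
  then have "complex_of_real ((norm (\<pi> h x))\<^sup>2) = complex_of_real ((norm x)\<^sup>2)"
    by (metis cinner_pi cinner_self)
  then show ?thesis
    by (simp only: of_real_eq_iff) simp
qed

lemma cinner_pi_right: "h \<in> SO_group \<Longrightarrow> cinner x (\<pi> h y) = cinner (\<pi> (matrix_inv h) x) y"
  using cinner_pi[of h "\<pi> (matrix_inv h) x" y] pi_mult[of h "matrix_inv h" x]
  by (simp add: SO_group_inv invertible_matrix_inv SO_group_invertible pi_id)

lemma pi_e: "h \<in> SO_group \<Longrightarrow> \<pi> h e = \<iota> (tau h const_one)"
  by (rule extends_tau[OF _ const_one_in_H_one])

text \<open>Cyclicity of \<open>e\<close>, with one set and one family of coefficients serving both
  the function and its image.\<close>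

lemma iota_expand:
  assumes "f \<in> H_one"
  obtains S c where "finite S" "S \<subseteq> SO_group" "f = (\<lambda>\<eta>. \<Sum>h\<in>S. c h * tau h const_one \<eta>)"
    "\<iota> f = (\<Sum>h\<in>S. c h *\<^sub>C \<pi> h e)"
proof -
  obtain S c where S: "finite S" "S \<subseteq> (SO_group :: (real^('n+'m)^('n+'m)) set)"
      "f = (\<lambda>\<eta>. \<Sum>h\<in>S. c h * tau h const_one \<eta>)"
    using assms unfolding H_one_def by blast
  have "\<iota> f = (\<Sum>h\<in>S. c h *\<^sub>C \<iota> (tau h const_one))"
    unfolding S(3) using S(2) by (intro iota_sum tau_in_H_one) auto
  also have "\<dots> = (\<Sum>h\<in>S. c h *\<^sub>C \<pi> h e)"
    using S(2) by (intro sum.cong refl) (auto simp: pi_e)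
  finally show thesis
    using that S by blast
qed

lemma iota_in_span:
  assumes "f \<in> H_one"
  obtains S c where "finite S" "S \<subseteq> SO_group" "\<iota> f = (\<Sum>h\<in>S. c h *\<^sub>C \<pi> h e)"
  by (rule iota_expand[OF assms]) (rule that; assumption)

text \<open>On a translate of the constant both sides come from \<open>embed A ** h\<close> by
  multiplicativity of \<open>\<pi>\<close>; linearity does the rest.\<close>

lemma iota_rot:
  assumes A: "A \<in> rotations TYPE('m)" and f: "f \<in> H_one"
  shows "\<iota> (rot A f) = \<pi> (embed A) (\<iota> f)"
proof -
  obtain S c where S: "finite S" "S \<subseteq> (SO_group :: (real^('n+'m)^('n+'m)) set)"
      "f = (\<lambda>\<eta>. \<Sum>h\<in>S. c h * tau h const_one \<eta>)" "\<iota> f = (\<Sum>h\<in>S. c h *\<^sub>C \<pi> h e)"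
    using iota_expand[OF f] .
  have EA: "embed A \<in> (SO_group :: (real^('n+'m)^('n+'m)) set)"
    using A by (rule embed_in_SO_group)
  have "rot A f = (\<lambda>\<eta>. \<Sum>h\<in>S. c h * rot A (tau h const_one) \<eta>)"
    by (simp add: S(3) rot_def)
  then have "\<iota> (rot A f) = (\<Sum>h\<in>S. c h *\<^sub>C \<iota> (rot A (tau h const_one)))"
    using S(2) by (simp add: iota_sum rot_H_one[OF A] tau_in_H_one subset_iff)
  also have "\<dots> = (\<Sum>h\<in>S. c h *\<^sub>C \<pi> (embed A) (\<pi> h e))"
  proof (rule sum.cong[OF refl])
    fix h assume "h \<in> S"
    then have h: "h \<in> SO_group"
      using S(2) by blast
    have "\<iota> (rot A (tau h const_one)) = \<pi> (embed A ** h) e"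
      by (simp add: rot_tau_const_one[OF A h] pi_e[OF SO_group_mult[OF EA h]])
    then show "c h *\<^sub>C \<iota> (rot A (tau h const_one)) = c h *\<^sub>C \<pi> (embed A) (\<pi> h e)"
      by (simp add: pi_mult[OF EA h])
  qed
  also have "\<dots> = \<pi> (embed A) (\<iota> f)"
    using EA by (simp add: S(4) pi_sum pi_scale)
  finally show ?thesis .
qed

lemma pi_embed_e: "A \<in> rotations TYPE('m) \<Longrightarrow> \<pi> (embed A) e = e"
  using iota_rot[OF _ const_one_in_H_one] by (simp add: rot_const_one)

lemma e_nonzero: "e \<noteq> 0"
proof
  assume "e = 0"
  then have "\<iota> const_one = \<iota> (\<lambda>_. 0)"
    by (simp add: iota_zero)
  \<comment> \<open>Membership in \<open>null_space\<close> includes membership in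
    \<open>C0\<close>, which is what the nonvanishing of the form asks for.\<close>
  then have "const_one \<in> null_space \<omega>"
    using iota_eq[OF const_one_in_H_one H_one_zero] by simp
  then show False
    unfolding null_space_def using C0_form_const_one_nonzero by blast
qed

text \<open>Some \<open>\<iota> f\<close> is closer to a nonzero \<open>w\<close> than
  \<open>norm w\<close>. As it is orthogonal to \<open>w\<close>, Cauchy-Schwarz would make the
  square of \<open>norm w\<close> smaller than itself.\<close>

lemma eq_zero_if_orthogonal:
  assumes "\<And>f. f \<in> H_one \<Longrightarrow> cinner w (\<iota> f) = 0"
  shows "w = 0"
proof (rule ccontr)
  assume "w \<noteq> 0"
  then obtain f where f: "f \<in> H_one" "dist (\<iota> f) w < norm w"
    using iota_dense closure_approachable[of w "\<iota> ` H_one"] by (metis UNIV_I imageE zero_less_norm_iff)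
  have "cinner w w = cinner w (w - \<iota> f)"
    using assms[OF f(1)] by (simp add: cinner_diff_right)
  then have "(norm w)\<^sup>2 \<le> norm w * norm (w - \<iota> f)"
    by (metis cinner_Cauchy_Schwarz cinner_self norm_of_real abs_of_nonneg zero_le_power2)
  moreover have "norm w * norm (w - \<iota> f) < norm w * norm w"
    using f(2) \<open>w \<noteq> 0\<close> by (simp add: dist_norm norm_minus_commute)
  ultimately show False
    by (simp add: power2_eq_square)
qed

text \<open>If \<open>F_lim \<omega> g\<close> is integrable, its L1 norm serves as
  \<open>K\<close>. Otherwise \<open>g\<close> pairs to zero with all translates of the constant,
  hence with itself, and \<open>\<iota> g = 0\<close> allows \<open>K = 0\<close>.\<close>

lemma uniform_bound:
  assumes g: "g \<in> H_one"
  obtains K where "K \<ge> 0"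
    "\<And>f \<epsilon>. f \<in> H_one \<Longrightarrow> \<epsilon> \<ge> 0 \<Longrightarrow> (\<And>y. y \<in> stiefel \<Longrightarrow> cmod (f y) \<le> \<epsilon>) \<Longrightarrow>
      cmod (cinner (\<iota> f) (\<iota> g)) \<le> \<epsilon> * K"
proof (cases "integrable \<omega> (F_lim \<omega> g)")
  case True
  show thesis
    by (rule that[of "LINT u|\<omega>. cmod (F_lim \<omega> g u)"])
       (auto simp: cinner_iota g intro: C0_form_bound[OF True])
next
  case False
  obtain S c where S: "finite S" "S \<subseteq> (SO_group :: (real^('n+'m)^('n+'m)) set)"
      "\<iota> g = (\<Sum>h\<in>S. c h *\<^sub>C \<pi> h e)"
    using iota_in_span[OF g] .
  have "cinner (\<pi> h e) (\<iota> g) = 0" if "h \<in> S" for h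
    using that S(2) F_lim_integrable_or_form_zero[of h g] False
    by (auto simp: pi_e cinner_iota tau_in_H_one g subset_iff)
  then have "cinner (\<Sum>h\<in>S. c h *\<^sub>C \<pi> h e) (\<iota> g) = 0"
    by (simp add: cinner_sum_left cinner_scaleC_left)
  then have "cinner (\<iota> g) (\<iota> g) = 0"
    using S(3) by simp
  then have "\<iota> g = 0"
    by (simp add: cinner_self)
  then show thesis
    using that[of 0] by (simp add: cinner_zero_right)
qed

section \<open>Averaging operators on the Hilbert space\<close>

definition mean :: "(real^'n^'n) set \<Rightarrow> 'k \<Rightarrow> 'k" where
  "mean S x = complex_of_real (1 / real (card S)) *\<^sub>C (\<Sum>A\<in>S. \<pi> (embed A) x)"

context
  fixes S :: "(real^'n^'n) set"
  assumes S: "finite S" "S \<noteq> {}" "S \<subseteq> rotations TYPE('m)"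
begin

lemma embed_S: "A \<in> S \<Longrightarrow> embed A \<in> (SO_group :: (real^('n+'m)^('n+'m)) set)"
  using S(3) by (intro embed_in_SO_group) auto

lemma card_S: "real (card S) > 0"
  using S by (simp add: card_gt_0_iff)

lemma avg_eq:
  fixes f :: "real^'m^'n \<Rightarrow> complex"
  shows "avg S f = (\<lambda>y. \<Sum>A\<in>S. complex_of_real (1 / real (card S)) * rot A f y)"
  by (simp add: fun_eq_iff avg_def rot_def sum_distrib_left scaleR_conv_of_real)

lemma avg_H_one:
  fixes f :: "real^'m^'n \<Rightarrow> complex"
  shows "f \<in> H_one \<Longrightarrow> avg S f \<in> H_one"
  unfolding avg_eq using S(3) by (intro H_one_sum H_one_scale rot_H_one) auto

lemma iota_avg: "f \<in> H_one \<Longrightarrow> \<iota> (avg S f) = mean S (\<iota> f)"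
  unfolding avg_eq mean_def
  using S(3) by (subst iota_sum) (auto simp: scaleC_sum_right iota_rot subset_iff intro!: rot_H_one sum.cong)

lemma avg_iter: "f \<in> H_one \<Longrightarrow> (avg S ^^ k) f \<in> H_one \<and> \<iota> ((avg S ^^ k) f) = (mean S ^^ k) (\<iota> f)"
  by (induction k) (auto simp: avg_H_one iota_avg)

lemma mean_diff: "mean S (x - y) = mean S x - mean S y"
  by (simp add: mean_def pi_diff embed_S sum_subtractf scaleC_diff_right)

lemma norm_mean_le: "norm (mean S x) \<le> norm x"
proof -
  have "norm (\<Sum>A\<in>S. \<pi> (embed A) x) \<le> (\<Sum>A\<in>S. norm x)"
    by (rule order.trans[OF norm_sum]) (simp add: norm_pi embed_S)
  then show ?thesis
    using card_S by (simp add: mean_def norm_scaleC norm_divide field_simps)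
qed

text \<open>Averages of unitary operators do not expand distances, so an arbitrary vector may be
  replaced by a nearby one from the dense span before averaging.\<close>

lemma norm_mean_iter_diff_le: "norm ((mean S ^^ k) x - (mean S ^^ k) y) \<le> norm (x - y)"
proof (induction k)
  case (Suc k)
  have "norm ((mean S ^^ Suc k) x - (mean S ^^ Suc k) y) = norm (mean S ((mean S ^^ k) x - (mean S ^^ k) y))"
    by (simp add: mean_diff)
  also note norm_mean_le
  also note Suc
  finally show ?case .
qed simp

text \<open>Rotations fix \<open>e\<close> and preserve the inner product, so averaging keeps the
  component along \<open>e\<close>. This later identifies the limit.\<close>

lemma cinner_mean_e: "cinner (mean S x) e = cinner x e"
proof -
  have "cinner (\<pi> (embed A) x) e = cinner x e" if "A \<in> S" for A
    using cinner_pi[OF embed_S[OF that], of x e] pi_embed_e[of A] that S(3) by auto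
  then show ?thesis
    using card_S by (simp add: mean_def cinner_scaleC_left cinner_sum_left)
qed

lemma cinner_mean_iter_e: "cinner ((mean S ^^ k) x) e = cinner x e"
  by (induction k) (auto simp: cinner_mean_e)

lemma mean_iter_mem:
  assumes W: "closed_csubspace W" "\<forall>g\<in>SO_group. \<pi> g ` W \<subseteq> W" and x: "x \<in> W"
  shows "(mean S ^^ k) x \<in> W"
proof (induction k)
  case (Suc k)
  have sum: "(\<Sum>A\<in>T. \<pi> (embed A) y) \<in> W" if "T \<subseteq> S" "y \<in> W" for T y
    using finite_subset[OF that(1) S(1)] that
  proof (induction T rule: finite_induct)
    case (insert A T)
    then have "\<pi> (embed A) y \<in> W"
      using W(2) embed_S by blast
    with insert W(1) show ?case
      by (simp add: closed_csubspace_def)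
  qed (use W(1) in \<open>simp add: closed_csubspace_def\<close>)
  show ?case
    using sum[OF subset_refl Suc] W(1) by (simp add: mean_def closed_csubspace_def)
qed (use x in simp)

text \<open>The adjoint of a rotation is a rotation, so each one applied to \<open>y\<close> can be
  moved to \<open>x\<close>, where it is absorbed by the quantifier over \<open>B\<close>. The
  average in the second argument, which varies with \<open>k\<close>, is thereby traded for the
  fixed \<open>y\<close>.\<close>

lemma cinner_mean_bound:
  assumes "\<And>B. B \<in> rotations TYPE('m) \<Longrightarrow> cmod (cinner (\<pi> (embed B) x) y) \<le> M"
    and B: "B \<in> rotations TYPE('m)"
  shows "cmod (cinner (\<pi> (embed B) x) ((mean S ^^ k) y)) \<le> M"
  using B
proof (induction k arbitrary: B)
  case (Suc k)
  have "cmod (cinner (\<pi> (embed B) x) (\<pi> (embed A) ((mean S ^^ k) y))) \<le> M" if A: "A \<in> S" for A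
  proof -
    have rot: "transpose A ** B \<in> rotations TYPE('m)"
      using A S(3) Suc.prems transpose_rotation[of A, where ?'m='m]
      by (auto simp: rotations_def orthogonal_matrix_mul embed_mult det_mul)
    have "orthogonal_matrix (embed A :: real^('n+'m)^('n+'m))"
      using A S(3) by (intro orthogonal_matrix_embed) (auto simp: rotations_def)
    then have "matrix_inv (embed A :: real^('n+'m)^('n+'m)) = embed (transpose A)"
      by (intro matrix_inv_unique) (simp add: orthogonal_matrix_def flip: transpose_embed)
    moreover have "embed (transpose A) \<in> (SO_group :: (real^('n+'m)^('n+'m)) set)"
      using A S(3) by (intro embed_in_SO_group transpose_rotation) auto
    ultimately have "cinner (\<pi> (embed B) x) (\<pi> (embed A) ((mean S ^^ k) y))
        = cinner (\<pi> (embed (transpose A ** B)) x) ((mean S ^^ k) y)"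
      using embed_in_SO_group[OF Suc.prems]
      by (simp add: cinner_pi_right[OF embed_S[OF A]] embed_mult pi_mult)
    then show ?thesis
      using Suc.IH[OF rot] by simp
  qed
  then have "cmod (\<Sum>A\<in>S. cinner (\<pi> (embed B) x) (\<pi> (embed A) ((mean S ^^ k) y))) \<le> (\<Sum>A\<in>S. M)"
    by (intro order.trans[OF norm_sum] sum_mono)
  then show ?case
    using card_S
    by (simp add: mean_def[of S "(mean S ^^ k) y"] cinner_scaleC_right cinner_sum_right norm_mult norm_divide field_simps)
qed (use assms(1) in simp)

end

text \<open>Subtracting a value of the averaged function leaves \<open>d\<close>, uniformly small
  and in the orbit span. Its Hilbert norm is controlled by constants belonging to \<open>f\<close>
  and to 1, both available before \<open>S\<close> and \<open>k\<close> are chosen.\<close>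

lemma mean_tends_to_multiple_of_e:
  assumes f: "f \<in> H_one" and \<epsilon>: "\<epsilon> > 0"
  obtains S k a where "finite S" "S \<noteq> {}" "S \<subseteq> rotations TYPE('m)"
    "norm ((mean S ^^ k) (\<iota> f) - a *\<^sub>C e) \<le> \<epsilon>"
proof -
  obtain y0 where y0: "y0 \<in> (stiefel :: (real^'m^'n) set)"
    using not_empty space_omega by blast
  obtain B where B: "B > 0" "\<And>y. y \<in> stiefel \<Longrightarrow> cmod (f y) \<le> B"
    using continuous_bounded[OF H_one_continuous[OF f]] by blast
  obtain K where K: "K \<ge> 0" "\<And>g \<delta>. g \<in> H_one \<Longrightarrow> \<delta> \<ge> 0 \<Longrightarrow> (\<And>y. y \<in> stiefel \<Longrightarrow> cmod (g y) \<le> \<delta>) \<Longrightarrow>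
      cmod (cinner (\<iota> g) (\<iota> f)) \<le> \<delta> * K"
    using uniform_bound[OF f] by blast
  obtain K' where K': "K' \<ge> 0" "\<And>g \<delta>. g \<in> H_one \<Longrightarrow> \<delta> \<ge> 0 \<Longrightarrow> (\<And>y. y \<in> stiefel \<Longrightarrow> cmod (g y) \<le> \<delta>) \<Longrightarrow>
      cmod (cinner (\<iota> g) e) \<le> \<delta> * K'"
    using uniform_bound[OF const_one_in_H_one] by blast
  \<comment> \<open>Chosen so that the final estimate \<open>\<delta> * (K + B * K' + 1)\<close> is
    the square of \<open>\<epsilon>\<close>; the 1 keeps the denominator positive when both
    constants vanish.\<close>
  define \<delta> where "\<delta> = \<epsilon>\<^sup>2 / (K + B * K' + 1)"
  have den: "K + B * K' + 1 > 0"
    using K(1) K'(1) B(1) by (simp add: add_nonneg_pos)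
  then have \<delta>: "\<delta> > 0"
    using \<epsilon> by (simp add: \<delta>_def)
  obtain S k where S: "finite S" "S \<noteq> {}" "S \<subseteq> rotations TYPE('m)"
    and near: "\<And>x y. x \<in> stiefel \<Longrightarrow> y \<in> stiefel \<Longrightarrow> cmod ((avg S ^^ k) f x - (avg S ^^ k) f y) \<le> \<delta>"
    using avg_near_constant[OF card_less H_one_continuous[OF f] \<delta>] by blast
  define a where "a = (avg S ^^ k) f y0"
  have "cmod ((avg S ^^ j) f y) \<le> B" if "y \<in> stiefel" for j y
    using that
  proof (induction j arbitrary: y)
    case (Suc j)
    have "cmod (avg S ((avg S ^^ j) f) y) \<le> B"
      using S(3) Suc by (intro norm_avg_le[OF S(1,2)] Suc.IH rotation_stiefel) auto
    then show ?case by simp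
  qed (use B(2) in simp)
  then have a: "cmod a \<le> B"
    unfolding a_def using y0 by blast
  define d where "d = (\<lambda>y. (avg S ^^ k) f y - a * const_one y)"
  have d: "d \<in> H_one" and iota_d: "\<iota> d = (mean S ^^ k) (\<iota> f) - a *\<^sub>C e"
    using avg_iter[OF S f, of k] H_one_scale[OF const_one_in_H_one, of a]
      H_one_diff[of "(avg S ^^ k) f" "\<lambda>y. a * const_one y"]
      iota_diff[of "(avg S ^^ k) f" "\<lambda>y. a * const_one y"]
    by (auto simp: d_def iota_scale const_one_in_H_one)
  have small: "cmod (d y) \<le> \<delta>" if "y \<in> stiefel" for y
    using near[OF that y0] that by (simp add: d_def a_def const_one_def)
  \<comment> \<open>A rotated \<open>d\<close> obeys the same uniform bound as \<open>d\<close>, so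
    the constant of \<open>f\<close> covers all rotations at once.\<close>
  have "cmod (cinner (\<pi> (embed A) (\<iota> d)) (\<iota> f)) \<le> \<delta> * K" if A: "A \<in> rotations TYPE('m)" for A
    unfolding iota_rot[OF A d, symmetric] using small \<delta> A d
    by (intro K(2) rot_H_one) (auto simp: rot_def rotation_stiefel)
  from cinner_mean_bound[OF S this id_in_rotations, of k]
  have 1: "cmod (cinner (\<iota> d) ((mean S ^^ k) (\<iota> f))) \<le> \<delta> * K"
    by (simp add: embed_id pi_id)
  have 2: "cmod (cinner (\<iota> d) e) \<le> \<delta> * K'"
    using small \<delta> d by (intro K'(2)) auto
  have "(norm (\<iota> d))\<^sup>2 = cmod (cinner (\<iota> d) (\<iota> d))"
    by (simp add: cinner_self norm_power)
  \<comment> \<open>Only the second argument is expanded: the first keeps the smallness, and the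
    second is reduced to \<open>f\<close> and the constant.\<close>
  also have "cinner (\<iota> d) (\<iota> d) = cinner (\<iota> d) ((mean S ^^ k) (\<iota> f)) - cnj a * cinner (\<iota> d) e"
    by (subst (2) iota_d) (simp add: cinner_diff_right cinner_scaleC_right)
  also have "cmod \<dots> \<le> \<delta> * K + B * (\<delta> * K')"
    using 1 mult_mono[OF a 2] B(1)
    by (intro order.trans[OF norm_triangle_ineq4] add_mono) (auto simp: norm_mult)
  also have "\<dots> \<le> \<delta> * (K + B * K' + 1)"
    using \<delta> by (simp add: algebra_simps)
  also have "\<dots> = \<epsilon>\<^sup>2"
    using den by (simp add: \<delta>_def)
  finally have "norm (\<iota> d) \<le> \<epsilon>"
    by (rule power2_le_imp_le) (use \<epsilon> in simp)
  then show thesis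
    using that[OF S, of k a] by (simp add: iota_d)
qed

text \<open>Averages of \<open>w\<close> lie in \<open>W\<close> and come close to some
  \<open>a *\<^sub>C e\<close>, where \<open>a\<close> is not known beforehand. Their component
  along \<open>e\<close> is that of \<open>w\<close>, which forces \<open>a\<close> to be close to
  the coefficient of the projection.\<close>

lemma projection_in_invariant_subspace:
  assumes W: "closed_csubspace W" "\<forall>g\<in>SO_group. \<pi> g ` W \<subseteq> W" and w: "w \<in> W"
  shows "(cinner w e / cinner e e) *\<^sub>C e \<in> W"
proof -
  have ne: "norm e > 0"
    using e_nonzero by simp
  define c where "c = cinner w e / cinner e e"
  have "\<exists>x\<in>W. dist x (c *\<^sub>C e) < \<epsilon>" if \<epsilon>: "\<epsilon> > 0" for \<epsilon>
  proof -
    \<comment> \<open>One fifth is spent on approximating \<open>w\<close> and one on averaging; the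
      same two fifths return when \<open>a\<close> is replaced by \<open>c\<close>, and four fifths
      stay below \<open>\<epsilon>\<close>.\<close>
    obtain f where f: "f \<in> H_one" "dist (\<iota> f) w < \<epsilon> / 5"
      using iota_dense closure_approachable[of w "\<iota> ` H_one"] \<epsilon>
      by (metis UNIV_I imageE divide_pos_pos zero_less_numeral)
    obtain S k a where S: "finite S" "S \<noteq> {}" "S \<subseteq> rotations TYPE('m)"
      and near: "norm ((mean S ^^ k) (\<iota> f) - a *\<^sub>C e) \<le> \<epsilon> / 5"
      using mean_tends_to_multiple_of_e[OF f(1), of "\<epsilon> / 5"] \<epsilon> by auto
    define u where "u = (mean S ^^ k) w"
    have "norm (u - (mean S ^^ k) (\<iota> f)) \<le> \<epsilon> / 5"
      using norm_mean_iter_diff_le[OF S, of k w "\<iota> f"] f(2)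
      by (simp add: u_def dist_norm norm_minus_commute)
    then have u: "norm (u - a *\<^sub>C e) \<le> 2 * \<epsilon> / 5"
      using near norm_triangle_ineq[of "u - (mean S ^^ k) (\<iota> f)" "(mean S ^^ k) (\<iota> f) - a *\<^sub>C e"] by simp
    \<comment> \<open>Thus \<open>(c - a) *\<^sub>C e\<close> is the orthogonal projection of
      \<open>u - a *\<^sub>C e\<close> to the line of \<open>e\<close>, and is no longer than that
      vector.\<close>
    have "cinner (u - a *\<^sub>C e) e = (c - a) * cinner e e"
      using ne cinner_mean_iter_e[OF S, of k w]
      by (simp add: u_def c_def cinner_diff_left cinner_scaleC_left cinner_self field_simps)
    then have "cmod (c - a) * (norm e)\<^sup>2 \<le> norm (u - a *\<^sub>C e) * norm e"
      by (metis cinner_Cauchy_Schwarz cinner_self norm_mult norm_of_real abs_of_nonneg zero_le_power2)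
    then have "norm ((c - a) *\<^sub>C e) \<le> norm (u - a *\<^sub>C e)"
      using ne by (simp add: norm_scaleC power2_eq_square mult.assoc[symmetric])
    moreover have "(c - a) *\<^sub>C e = c *\<^sub>C e - a *\<^sub>C e"
      using scaleC_add_left[of "c - a" a e] by (simp add: algebra_simps)
    ultimately have "norm (c *\<^sub>C e - a *\<^sub>C e) \<le> 2 * \<epsilon> / 5"
      using u by simp
    then have "dist u (c *\<^sub>C e) < \<epsilon>"
      using u \<epsilon> norm_triangle_ineq4[of "u - a *\<^sub>C e" "c *\<^sub>C e - a *\<^sub>C e"] by (simp add: dist_norm)
    moreover have "u \<in> W"
      unfolding u_def by (rule mean_iter_mem[OF S W w])
    ultimately show ?thesis by blast
  qed
  then have "c *\<^sub>C e \<in> closure W"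
    by (simp add: closure_approachable)
  then show ?thesis
    using W(1) by (simp add: closed_csubspace_def c_def)
qed

lemma cyclic_in_invariant_subspace:
  assumes W: "closed_csubspace W" "\<forall>g\<in>SO_group. \<pi> g ` W \<subseteq> W" and e: "e \<in> W"
  shows "W = UNIV"
proof -
  have "\<iota> f \<in> W" if f: "f \<in> H_one" for f
  proof -
    obtain S c where S: "finite S" "S \<subseteq> (SO_group :: (real^('n+'m)^('n+'m)) set)"
        "\<iota> f = (\<Sum>h\<in>S. c h *\<^sub>C \<pi> h e)"
      using iota_in_span[OF f] .
    have "(\<Sum>h\<in>S. c h *\<^sub>C \<pi> h e) \<in> W"
      using S(1,2)
    proof (induction S rule: finite_induct)
      case (insert h S)
      then have "\<pi> h e \<in> W"
        using W(2) e by blast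
      with insert W(1) show ?case
        by (simp add: closed_csubspace_def)
    qed (use W(1) in \<open>simp add: closed_csubspace_def\<close>)
    with S(3) show ?thesis by simp
  qed
  then have "closure (\<iota> ` H_one) \<subseteq> W"
    using W(1) by (intro closure_minimal) (auto simp: closed_csubspace_def)
  then show ?thesis
    using iota_dense by auto
qed

lemma irreducible: "irreducible_representation SO_group \<pi>"
  unfolding irreducible_representation_def
proof (intro conjI allI impI)
  show "(UNIV :: 'k set) \<noteq> {0}"
    using e_nonzero by blast
next
  fix W assume "closed_csubspace W \<and> (\<forall>g\<in>SO_group. \<pi> g ` W \<subseteq> W)"
  then have W: "closed_csubspace W" "\<forall>g\<in>SO_group. \<pi> g ` W \<subseteq> W"
    by auto
  show "W = {0} \<or> W = UNIV"
  proof (rule disjCI)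
    assume "W \<noteq> UNIV"
    have "w = 0" if w: "w \<in> W" for w
    proof (rule ccontr)
      assume "w \<noteq> 0"
      then obtain f where f: "f \<in> H_one" "cinner w (\<iota> f) \<noteq> 0"
        using eq_zero_if_orthogonal by blast
      obtain S c where S: "finite S" "S \<subseteq> (SO_group :: (real^('n+'m)^('n+'m)) set)"
          "\<iota> f = (\<Sum>h\<in>S. c h *\<^sub>C \<pi> h e)"
        using iota_in_span[OF f(1)] .
      then have "(\<Sum>h\<in>S. cnj (c h) * cinner w (\<pi> h e)) \<noteq> 0"
        using f(2) by (simp add: cinner_sum_right cinner_scaleC_right)
      then obtain h where h: "h \<in> S" "cinner w (\<pi> h e) \<noteq> 0"
        by (metis (mono_tags, lifting) mult_zero_right sum.neutral)
      then have hG: "h \<in> SO_group"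
        using S(2) by blast
      \<comment> \<open>By unitarity the component of \<open>w\<close> along
        \<open>\<pi> h e\<close> is the component of this translate along \<open>e\<close>.\<close>
      define w' where "w' = \<pi> (matrix_inv h) w"
      have w': "w' \<in> W"
        unfolding w'_def using W(2) SO_group_inv[OF hG] w by blast
      have nz: "cinner w' e \<noteq> 0"
        using h(2) by (simp add: w'_def cinner_pi_right[OF hG])
      define c where "c = cinner w' e / cinner e e"
      have "c \<noteq> 0"
        using nz e_nonzero by (simp add: c_def cinner_self)
      have "inverse c *\<^sub>C c *\<^sub>C e \<in> W"
        using projection_in_invariant_subspace[OF W w'] W(1) by (simp add: c_def closed_csubspace_def)
      then have "e \<in> W"
        using \<open>c \<noteq> 0\<close> by (simp add: scaleC_scaleC scaleC_one)
      then show False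
        using cyclic_in_invariant_subspace[OF W] \<open>W \<noteq> UNIV\<close> by blast
    qed
    then show "W = {0}"
      using W(1) by (auto simp: closed_csubspace_def)
  qed
qed

end

theorem proposition20:
  fixes \<omega> :: "(real^'m::finite^'n::finite) measure"
    and \<iota> :: "(real^'m^'n \<Rightarrow> complex) \<Rightarrow> 'k::complex_hilbert_space"
    and \<pi> :: "real^('n+'m)^('n+'m) \<Rightarrow> 'k \<Rightarrow> 'k"
  assumes dims: "CARD('m) \<ge> 1" "CARD('n) \<ge> CARD('m)" "int CARD('n) - int CARD('m) > 2"
    and omega: "normalised_invariant_measure \<omega>"
    and completion: "hilbert_completion H_one (null_space \<omega> \<inter> H_one) (C0_form \<omega>) \<iota>"
    and unitary: "unitary_representation SO_group \<pi>"
    and extends_tau: "\<And>h f. h \<in> SO_group \<Longrightarrow> f \<in> H_one \<Longrightarrow> \<pi> h (\<iota> f) = \<iota> (tau h f)"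
  shows "irreducible_representation SO_group \<pi>"
proof -
  interpret tau_completion \<omega> \<iota> \<pi>
    using assms by unfold_locales (auto simp: normalised_invariant_measure_def)
  show ?thesis
    by (rule irreducible)
qed

end
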